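(* Let $G=\frac{1+\sqrt5}{2}$, let $\lambda>1$ be the unique real root of $x^3-x^2-x-1=0$, and let $\alpha=\frac{\log\lambda}{2\log G}$. The function $Q_O$ on $[0,1]$ is Hölder continuous with best exponent $\alpha$; that is, there is a constant $C>0$ with $|Q_O(x)-Q_O(x')|\le C|x-x'|^{\alpha}$ for all $x,x'\in[0,1]$, and for no $\beta>\alpha$ is $Q_O$ Hölder continuous with exponent $\beta$.
   Context: Odd continued fractions (OCF). Every $x\in(0,1]$ has a unique expansion $$x=[(e_1,a_1),(e_2,a_2),(e_3,a_3),\ldots]=\cfrac{e_1}{a_1+\cfrac{e_2}{a_2+\cfrac{e_3}{\ddots}}},$$ where $e_i\in\{\pm1\}$, $e_1=1$, each $a_i$ is an odd positive integer, and $a_i+e_{i+1}>0$ for all $i$; the expansion is finite if $x$ is rational and infinite if $x$ is irrational, and in a finite expansion it is required that if the last partial quotient $a_j$ equals $1$ then $e_j=1$. The number $0$ has the empty expansion. With $\lambda>1$ the unique real root of $x^3-x^2-x-1=0$, the function $Q_O:[0,1]\to[0,1]$ is defined by $$Q_O([(e_1,a_1),(e_2,a_2),\ldots])=-\sum_{k\ge1}\frac{(-e_1)(-e_2)\cdots(-e_k)}{\lambda^{a_1+\cdots+a_k-1}},$$ the sum being over all $k\geq 1$ for infinite expansions and over $1\le k\le n$ for finite expansions of length $n$ (so $Q_O(0)=0$). *)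

theory Defs
  imports "HOL-Analysis.Analysis"
begin

definition hoelder_continuous_on :: "real set \<Rightarrow> real \<Rightarrow> (real \<Rightarrow> real) \<Rightarrow> bool" where
  "hoelder_continuous_on S \<beta> f \<longleftrightarrow>
     (\<exists>C>0. \<forall>x\<in>S. \<forall>y\<in>S. \<bar>f x - f y\<bar> \<le> C * \<bar>x - y\<bar> powr \<beta>)"

definition golden_ratio :: real where
  "golden_ratio = (1 + sqrt 5) / 2"

definition ocf_lambda :: real where
  "ocf_lambda = (THE x::real. x > 1 \<and> x ^ 3 - x ^ 2 - x - 1 = 0)"

text \<open>
  A digit is a pair \<open>(e, a)\<close> of a sign and an odd partial quotient. Positions are counted
  from \<open>0\<close>, so \<open>d ! 0\<close> and \<open>d 0\<close> stand for \<open>(e\<^sub>1, a\<^sub>1)\<close>. The empty list is admissible.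
\<close>

type_synonym ocf_digit = "int \<times> nat"

definition ocf_admissible_fin :: "ocf_digit list \<Rightarrow> bool" where
  "ocf_admissible_fin d \<longleftrightarrow>
     (\<forall>i<length d. fst (d ! i) \<in> {1, -1} \<and> odd (snd (d ! i))) \<and>
     (\<forall>i. Suc i < length d \<longrightarrow> int (snd (d ! i)) + fst (d ! Suc i) > 0) \<and>
     (d \<noteq> [] \<longrightarrow> fst (hd d) = 1 \<and> (snd (last d) = 1 \<longrightarrow> fst (last d) = 1))"

definition ocf_admissible_inf :: "(nat \<Rightarrow> ocf_digit) \<Rightarrow> bool" where
  "ocf_admissible_inf d \<longleftrightarrow>
     (\<forall>i. fst (d i) \<in> {1, -1} \<and> odd (snd (d i))) \<and>
     (\<forall>i. int (snd (d i)) + fst (d (Suc i)) > 0) \<and>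
     fst (d 0) = 1"

fun ocf_value :: "ocf_digit list \<Rightarrow> real" where
  "ocf_value [] = 0"
| "ocf_value ((e, a) # ds) = of_int e / (real a + ocf_value ds)"

definition ocf_expansion_fin :: "real \<Rightarrow> ocf_digit list \<Rightarrow> bool" where
  "ocf_expansion_fin x d \<longleftrightarrow> ocf_admissible_fin d \<and> ocf_value d = x"

text \<open>The value of an infinite continued fraction is the limit of its truncations.\<close>

definition ocf_expansion_inf :: "real \<Rightarrow> (nat \<Rightarrow> ocf_digit) \<Rightarrow> bool" where
  "ocf_expansion_inf x d \<longleftrightarrow>
     ocf_admissible_inf d \<and> (\<lambda>n. ocf_value (map d [0..<n])) \<longlonglongrightarrow> x"

text \<open>
  The term at position \<open>k\<close> is the \<open>(k + 1)\<close>-st term of the series. All partial quotients are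
  positive, so the subtraction in the exponent is not truncated.
\<close>

definition QO_term :: "(nat \<Rightarrow> ocf_digit) \<Rightarrow> nat \<Rightarrow> real" where
  "QO_term d k = (\<Prod>i\<le>k. - of_int (fst (d i))) / ocf_lambda ^ ((\<Sum>i\<le>k. snd (d i)) - 1)"

text \<open>Only the values on \<open>{0..1}\<close> are meaningful.\<close>

definition QO :: "real \<Rightarrow> real" where
  "QO x =
     (if x \<in> \<rat>
      then (let d = (THE d. ocf_expansion_fin x d) in - (\<Sum>k<length d. QO_term ((!) d) k))
      else (let d = (THE d. ocf_expansion_inf x d) in - (\<Sum>k. QO_term d k)))"

end

theory Submission
  imports Defs
begin

text \<open>
  Besides the digits, the expansion has a slow description. The unit interval is the union of the
  images of the three Moebius maps \<open>g\<^sub>1 y = 1 / (1 + y)\<close>, \<open>g\<^sub>2 y = y / (1 + 2y)\<close> and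
  \<open>g\<^sub>3 y = 1 / (3 - y)\<close>, namely \<open>[1/2, 1]\<close>, \<open>[0, 1/3]\<close> and \<open>[1/3, 1/2]\<close>. Each of them acts on the
  digits simply: \<open>g\<^sub>1\<close> prepends \<open>(1, 1)\<close>, \<open>g\<^sub>2\<close> adds \<open>2\<close> to the first partial quotient, and \<open>g\<^sub>3\<close>
  prepends \<open>(1, 3)\<close> after negating the first sign. Consequently \<open>QO\<close> turns \<open>g\<^sub>k\<close> into an affine
  map of slope \<open>\<plusminus>1 / \<lambda>^k\<close> (\<open>QO_invert\<close>, \<open>QO_parabolic\<close>, \<open>QO_middle\<close>). These three equations
  and the boundedness of \<open>QO\<close> are all that the Hoelder estimate uses. To derive them from the
  definition one needs that each point of the unit interval has exactly one expansion.

  The geometric side is the distance \<open>N x y = |x - y| / ((G + x) (G + y))\<close>. It is comparable with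
  \<open>|x - y|\<close>, and \<open>N (g\<^sub>k x) (g\<^sub>k y) \<ge> N x y / G^(2k)\<close> for all three maps (\<open>golden_dist_branch\<close>).
  With \<open>\<lambda> = G powr (2 \<alpha>)\<close>, applying \<open>g\<^sub>k\<close> to both points therefore preserves an inequality
  \<open>|QO x - QO y| \<le> C * N x y powr \<alpha>\<close> with the same \<open>C\<close>. It remains to treat points that lie in
  different branches. They are separated by \<open>1/3\<close> or \<open>1/2\<close>, and these cut points are images of \<open>0\<close>
  or \<open>1 = g\<^sub>1 0\<close>, so everything reduces to the pairs \<open>(x, 0)\<close>. For these, undoing \<open>g\<^sub>2\<close> moves \<open>x\<close>
  above \<open>1/3\<close>, where boundedness suffices (\<open>QO_close_zero\<close>, \<open>QO_close_unit\<close>).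

  For \<open>g\<^sub>1\<close> the distance inequality is an equality. The iterates \<open>g\<^sub>1\<^sup>n 0\<close> and \<open>g\<^sub>1\<^sup>n 1\<close> thus have
  distance of order \<open>G^(-2n)\<close> while their values differ by \<open>\<lambda>^(-n)\<close>, which excludes every larger
  exponent (\<open>QO_fibonacci_interval\<close>).
\<close>

section \<open>The two constants\<close>

lemma ocf_lambda_ex1: "\<exists>!x::real. x > 1 \<and> x ^ 3 - x ^ 2 - x - 1 = 0"
proof (rule ex_ex1I)
  have "\<exists>x\<ge>1. x \<le> 2 \<and> x ^ 3 - x ^ 2 - x - 1 = (0::real)"
    by (rule IVT') (auto intro!: continuous_intros)
  then obtain x :: real where x: "x \<ge> 1" "x ^ 3 - x ^ 2 - x - 1 = 0" by blast
  then have "x \<noteq> 1" by auto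
  with x show "\<exists>x::real. x > 1 \<and> x ^ 3 - x ^ 2 - x - 1 = 0"
    by (intro exI[of _ x]) simp
next
  fix x y :: real
  assume x: "x > 1 \<and> x ^ 3 - x ^ 2 - x - 1 = 0" and y: "y > 1 \<and> y ^ 3 - y ^ 2 - y - 1 = 0"
  have "x * x > x" "y * y > y" using x y by simp_all
  moreover have "x * y > 1" using x y by (simp add: less_1_mult)
  ultimately have "x * x + x * y + y * y - x - y - 1 > 0" by simp
  moreover have "(x - y) * (x * x + x * y + y * y - x - y - 1) = 0"
    using x y by (simp add: power3_eq_cube power2_eq_square algebra_simps)
  ultimately show "x = y" by simp
qed

lemma ocf_lambda_gt_1: "ocf_lambda > 1"
  and ocf_lambda_cubic: "ocf_lambda ^ 3 = ocf_lambda ^ 2 + ocf_lambda + 1"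
  using theI'[OF ocf_lambda_ex1] unfolding ocf_lambda_def[symmetric] by auto

lemma golden_ratio_gt_1: "golden_ratio > 1"
  and golden_ratio_square: "golden_ratio ^ 2 = golden_ratio + 1"
  unfolding golden_ratio_def by (simp_all add: power2_eq_square field_simps)

text \<open>
  Sharp enough for \<open>(G + 1)\<^sup>2 = 3G + 2 < 7\<close>.
\<close>

lemma golden_ratio_less: "golden_ratio < 13 / 8"
proof -
  have "sqrt 5 < 9 / 4" by (rule real_less_lsqrt) (simp_all add: power2_eq_square)
  then show ?thesis by (simp add: golden_ratio_def)
qed

section \<open>Partial sums of the series\<close>

definition ocf_partial :: "(nat \<Rightarrow> ocf_digit) \<Rightarrow> nat \<Rightarrow> real" where
  "ocf_partial d n = - (\<Sum>k<n. QO_term d k)"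

text \<open>
  Each digit contributes its own factor \<open>-e / \<lambda>^a\<close>; the shift by one in the exponent of the
  definition becomes a common factor \<open>\<lambda>\<close>. Multiplicativity is what makes prepending a digit act
  affinely on the sum.
\<close>

lemma QO_term_eq_prod:
  assumes "snd (d 0) \<ge> 1"
  shows "QO_term d k = ocf_lambda * (\<Prod>i\<le>k. - of_int (fst (d i)) / ocf_lambda ^ snd (d i))"
proof -
  have "(\<Sum>i\<le>k. snd (d i)) \<ge> snd (d 0)" by (rule member_le_sum) auto
  with assms have "(\<Sum>i\<le>k. snd (d i)) = Suc ((\<Sum>i\<le>k. snd (d i)) - 1)" by simp
  then have "ocf_lambda ^ (\<Sum>i\<le>k. snd (d i)) = ocf_lambda * ocf_lambda ^ ((\<Sum>i\<le>k. snd (d i)) - 1)"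
    by (metis power_Suc)
  then show ?thesis
    using ocf_lambda_gt_1 by (simp add: QO_term_def prod_dividef power_sum [symmetric] del: divide_minus_left)
qed

text \<open>
  This recursion is the source of all functional equations below. A digit sequence is written as
  \<open>case_nat (e, a) d\<close> throughout, so that one statement serves the finite expansions (through
  \<open>(!)\<close>, whose values beyond the end of the list are unspecified, whence the guard \<open>n > 0\<close>) and
  the infinite ones.
\<close>

lemma ocf_partial_case_nat:
  assumes "a \<ge> 1" and "n > 0 \<Longrightarrow> snd (d 0) \<ge> 1"
  shows "ocf_partial (case_nat (e, a) d) (Suc n)
    = of_int e * (ocf_lambda - ocf_partial d n) / ocf_lambda ^ a"
proof -
  have "QO_term (case_nat (e, a) d) (Suc k) = - of_int e / ocf_lambda ^ a * QO_term d k" if "k < n" for k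
    using assms that
    by (simp add: QO_term_eq_prod prod.atMost_Suc_shift del: prod.atMost_Suc)
  then have "(\<Sum>k<n. QO_term (case_nat (e, a) d) (Suc k)) = - of_int e / ocf_lambda ^ a * (\<Sum>k<n. QO_term d k)"
    by (simp add: sum_distrib_left)
  moreover have "QO_term (case_nat (e, a) d) 0 = - of_int e / ocf_lambda ^ a * ocf_lambda"
    using assms by (simp add: QO_term_eq_prod)
  ultimately show ?thesis
    by (simp add: ocf_partial_def sum.lessThan_Suc_shift algebra_simps add_divide_distrib del: sum.lessThan_Suc)
qed

lemma nth_Cons_fun: "(!) (x # xs) = case_nat x ((!) xs)"
  by (rule ext) (simp add: nth_Cons)

text \<open>
  As every partial quotient is at least \<open>1\<close>, the series is dominated by a geometric one. This
  gives the convergence for infinite expansions and a bound that is common to all expansions.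
\<close>

lemma abs_QO_term_le:
  assumes "\<And>i. i \<le> k \<Longrightarrow> fst (d i) \<in> {1, -1} \<and> odd (snd (d i))"
  shows "\<bar>QO_term d k\<bar> \<le> (1 / ocf_lambda) ^ k"
proof -
  have "\<bar>QO_term d k\<bar> = ocf_lambda * (\<Prod>i\<le>k. \<bar>- of_int (fst (d i)) / ocf_lambda ^ snd (d i)\<bar>)"
    using assms[of 0] ocf_lambda_gt_1
    by (subst QO_term_eq_prod) (auto simp: abs_mult abs_prod dest: odd_pos)
  also have "(\<Prod>i\<le>k. \<bar>- of_int (fst (d i)) / ocf_lambda ^ snd (d i)\<bar>) \<le> (\<Prod>i\<le>k. 1 / ocf_lambda)"
  proof (rule prod_mono)
    fix i assume "i \<in> {..k}"
    then have "fst (d i) \<in> {1, -1}" "odd (snd (d i))" using assms by auto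
    then have *: "\<bar>real_of_int (fst (d i))\<bar> = 1" "snd (d i) \<ge> 1" by (auto dest: odd_pos)
    have "ocf_lambda ^ 1 \<le> ocf_lambda ^ snd (d i)"
      using * ocf_lambda_gt_1 by (intro power_increasing) auto
    then show "0 \<le> \<bar>- of_int (fst (d i)) / ocf_lambda ^ snd (d i)\<bar> \<and>
        \<bar>- of_int (fst (d i)) / ocf_lambda ^ snd (d i)\<bar> \<le> 1 / ocf_lambda"
      using * ocf_lambda_gt_1 by (simp add: abs_divide frac_le)
  qed
  finally show ?thesis using ocf_lambda_gt_1 by (simp add: field_simps)
qed

lemma abs_ocf_partial_le:
  assumes "\<And>i. i < n \<Longrightarrow> fst (d i) \<in> {1, -1} \<and> odd (snd (d i))"
  shows "\<bar>ocf_partial d n\<bar> \<le> ocf_lambda / (ocf_lambda - 1)"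
proof -
  have "\<bar>ocf_partial d n\<bar> \<le> (\<Sum>k<n. \<bar>QO_term d k\<bar>)"
    unfolding ocf_partial_def abs_minus_cancel by (rule sum_abs)
  also have "\<dots> \<le> (\<Sum>k<n. (1 / ocf_lambda) ^ k)"
    using assms by (intro sum_mono abs_QO_term_le) auto
  also have "\<dots> \<le> (\<Sum>k. (1 / ocf_lambda) ^ k)"
    using ocf_lambda_gt_1 by (intro sum_le_suminf summable_geometric) auto
  also have "\<dots> = ocf_lambda / (ocf_lambda - 1)"
    using ocf_lambda_gt_1 by (subst suminf_geometric) (auto simp: field_simps)
  finally show ?thesis .
qed

lemma ocf_partial_tendsto:
  assumes "ocf_admissible_inf d"
  shows "ocf_partial d \<longlonglongrightarrow> - (\<Sum>k. QO_term d k)"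
proof -
  have "summable (QO_term d)"
  proof (rule summable_comparison_test')
    show "summable (\<lambda>k. (1 / ocf_lambda) ^ k)"
      using ocf_lambda_gt_1 by (intro summable_geometric) auto
    show "norm (QO_term d k) \<le> (1 / ocf_lambda) ^ k" if "k \<ge> 0" for k
      using assms unfolding real_norm_def by (intro abs_QO_term_le) (auto simp: ocf_admissible_inf_def)
  qed
  from summable_LIMSEQ[OF this] show ?thesis
    unfolding ocf_partial_def[abs_def] by (rule tendsto_minus)
qed

section \<open>Finite expansions\<close>

text \<open>
  The digits left after removing an initial segment of an expansion: the first sign is now
  arbitrary, so that the predicate is closed under taking tails and suits induction. The condition
  on the last digit excludes the tail \<open>[(-1, 1)]\<close>, whose value would be \<open>-1\<close>.
\<close>

fun ocf_tail :: "ocf_digit list \<Rightarrow> bool" where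
  "ocf_tail [] \<longleftrightarrow> True"
| "ocf_tail ((e, a) # ds) \<longleftrightarrow> e \<in> {1, -1} \<and> odd a \<and>
     (if ds = [] then a = 1 \<longrightarrow> e = 1 else int a + fst (hd ds) > 0) \<and> ocf_tail ds"

lemma ocf_tail_iff:
  "ocf_tail d \<longleftrightarrow>
     (\<forall>i<length d. fst (d ! i) \<in> {1, -1} \<and> odd (snd (d ! i))) \<and>
     (\<forall>i. Suc i < length d \<longrightarrow> int (snd (d ! i)) + fst (d ! Suc i) > 0) \<and>
     (d \<noteq> [] \<longrightarrow> snd (last d) = 1 \<longrightarrow> fst (last d) = 1)"
proof -
  have "ocf_tail d \<longleftrightarrow> (\<forall>p\<in>set d. fst p \<in> {1, -1} \<and> odd (snd p)) \<and>
     successively (\<lambda>p q. int (snd p) + fst q > 0) d \<and>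
     (d \<noteq> [] \<longrightarrow> snd (last d) = 1 \<longrightarrow> fst (last d) = 1)"
    by (induction d rule: ocf_tail.induct) (auto simp: successively_Cons)
  then show ?thesis
    by (simp add: successively_conv_nth all_set_conv_all_nth)
qed

lemma ocf_admissible_fin_iff_tail:
  "ocf_admissible_fin d \<longleftrightarrow> ocf_tail d \<and> (d \<noteq> [] \<longrightarrow> fst (hd d) = 1)"
  unfolding ocf_admissible_fin_def ocf_tail_iff by blast

text \<open>
  The half-open interval \<open>(-1, 1]\<close> has length \<open>2\<close>, the distance of consecutive odd numbers; so a
  value determines its first partial quotient. The denominator \<open>a + t\<close> is at least \<open>1\<close> because
  for \<open>a = 1\<close> the next sign is positive, and for \<open>a \<ge> 3\<close> because \<open>t > -1\<close>.
\<close>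

lemma ocf_tail_value_bounds:
  assumes "ocf_tail d"
  shows "- 1 < ocf_value d \<and> ocf_value d \<le> 1 \<and>
    (d \<noteq> [] \<longrightarrow> ocf_value d \<noteq> 0 \<and> sgn (ocf_value d) = of_int (fst (hd d)))"
  using assms
proof (induction d rule: ocf_tail.induct)
  case (2 e a ds)
  have e: "e = 1 \<or> e = -1" and a: "odd a" using 2 by auto
  have IH: "- 1 < ocf_value ds" "ocf_value ds \<le> 1"
    "ds \<noteq> [] \<Longrightarrow> sgn (ocf_value ds) = of_int (fst (hd ds))" using 2 by auto
  define s where "s = real a + ocf_value ds"
  have s: "s \<ge> 1 \<and> (s > 1 \<or> e = 1)"
  proof (cases "a = 1")
    case True
    show ?thesis
    proof (cases "ds = []")
      case False
      have "fst (hd ds) > -1" using 2 True False by auto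
      moreover have "fst (hd ds) \<in> {1, -1}" using 2 False by (cases ds rule: ocf_tail.cases) auto
      ultimately have "ocf_value ds > 0" using IH(3) False by (auto simp: sgn_1_pos)
      then show ?thesis using True by (simp add: s_def)
    qed (use 2 True in \<open>auto simp: s_def\<close>)
  next
    case False
    with a have "a \<ge> 3" by (cases a; auto elim!: oddE)
    then have "real a \<ge> 3" by simp
    then show ?thesis using IH by (simp add: s_def)
  qed
  have "ocf_value ((e, a) # ds) = of_int e / s" by (simp add: s_def)
  then show ?case using e s by (auto simp: field_simps)
qed simp

lemma odd_add_cancel:
  fixes s t :: real
  assumes "odd a" "odd b" "real a + s = real b + t" "\<bar>s - t\<bar> < 2"
  shows "a = b"
proof -
  obtain i j where ij: "a = 2 * i + 1" "b = 2 * j + 1" using assms(1,2) by (auto elim!: oddE)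
  then have "\<bar>real_of_int (int i - int j)\<bar> < 1" using assms(3,4) by auto
  then have "\<bar>int i - int j\<bar> < 1" by linarith
  then show ?thesis using ij by simp
qed

text \<open>
  The sign of the value is the first sign, the parity argument of \<open>odd_add_cancel\<close> yields the first
  partial quotient, and the remaining values agree.
\<close>

lemma ocf_tail_value_inj:
  "ocf_tail d \<Longrightarrow> ocf_tail d' \<Longrightarrow> ocf_value d = ocf_value d' \<Longrightarrow> d = d'"
proof (induction d arbitrary: d' rule: ocf_tail.induct)
  case 1
  then show ?case using ocf_tail_value_bounds[of d'] by auto
next
  case (2 e a ds)
  have "d' \<noteq> []" using 2(3,4) ocf_tail_value_bounds[OF 2(2)] by auto
  then obtain e' a' ds' where d': "d' = (e', a') # ds'" by (metis neq_Nil_conv surj_pair)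
  have "sgn (ocf_value d') = of_int e'" "sgn (ocf_value d') = of_int e"
    using ocf_tail_value_bounds[OF 2(2)] ocf_tail_value_bounds[OF 2(3)] 2(4) d'
    by (simp_all del: ocf_value.simps)
  then have e: "e' = e" by simp
  have e0: "e \<noteq> 0" and ta: "odd a" "odd a'" and t: "ocf_tail ds" "ocf_tail ds'"
    using 2(2,3) d' by auto
  have eq: "real a + ocf_value ds = real a' + ocf_value ds'"
    using 2(4) e0 by (simp add: d' e)
  have "a = a'"
    by (rule odd_add_cancel[OF ta eq])
       (use ocf_tail_value_bounds[OF t(1)] ocf_tail_value_bounds[OF t(2)] in linarith)
  moreover from this have "ds = ds'" using 2(1)[OF t] eq by simp
  ultimately show ?case using d' e by simp
qed

lemma QO_rational:
  assumes "x \<in> \<rat>" "ocf_expansion_fin x d"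
  shows "QO x = ocf_partial ((!) d) (length d)"
proof -
  have "(THE d. ocf_expansion_fin x d) = d"
    using assms(2) ocf_tail_value_inj
    by (intro the_equality) (auto simp: ocf_expansion_fin_def ocf_admissible_fin_iff_tail)
  then show ?thesis using assms(1) by (simp add: QO_def ocf_partial_def)
qed

lemma irrational_nonzero: "x \<notin> \<rat> \<Longrightarrow> x \<noteq> 0"
  by auto

text \<open>
  Each of the maps \<open>1/x - 1\<close>, \<open>3 - 1/x\<close> and \<open>x / (1 - 2x)\<close>, applied on \<open>[1/2, 1]\<close>, \<open>[1/3, 1/2]\<close>
  and \<open>[0, 1/3]\<close> respectively, keeps the fraction in the unit interval and lowers its denominator
  (for \<open>0 < x < 1\<close>). Undoing them prepends \<open>(1, 1)\<close>, prepends \<open>(1, 3)\<close> after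
  negating the first sign, or adds \<open>2\<close> to the first partial quotient.
\<close>

lemma ocf_expansion_fin_exists_quotient:
  "0 < q \<Longrightarrow> p \<le> q \<Longrightarrow> \<exists>d. ocf_expansion_fin (real p / real q) d"
proof (induction q arbitrary: p rule: less_induct)
  case (less q)
  consider "p = 0" | "p = q" | "p < q" "q \<le> 2 * p" | "2 * p < q" "q \<le> 3 * p"
    | "p > 0" "3 * p < q"
    using less.prems by linarith
  then show ?case
  proof cases
    case 1
    then show ?thesis by (intro exI[of _ "[]"]) (simp add: ocf_expansion_fin_def ocf_admissible_fin_iff_tail)
  next
    case 2
    then show ?thesis using less.prems
      by (intro exI[of _ "[(1, 1)]"]) (simp add: ocf_expansion_fin_def ocf_admissible_fin_iff_tail)
  next
    case 3
    then have "0 < p" "q - p \<le> p" by linarith+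
    then obtain d where d: "ocf_expansion_fin (real (q - p) / real p) d"
      using less.IH[OF \<open>p < q\<close>] by blast
    then have "1 + ocf_value d = real q / real p"
      using 3 \<open>0 < p\<close> by (simp add: ocf_expansion_fin_def of_nat_diff field_simps)
    then have "ocf_expansion_fin (real p / real q) ((1, 1) # d)"
      using d by (auto simp: ocf_expansion_fin_def ocf_admissible_fin_iff_tail)
    then show ?thesis by blast
  next
    case 4
    then have "p < q" "0 < p" "3 * p - q \<le> p" using less.prems by linarith+
    then obtain d where d: "ocf_expansion_fin (real (3 * p - q) / real p) d"
      using less.IH[OF \<open>p < q\<close>] by blast
    have val: "ocf_value d = (3 * real p - real q) / real p"
      using d 4 by (simp add: ocf_expansion_fin_def of_nat_diff)
    have adm: "ocf_tail d" "d \<noteq> [] \<longrightarrow> fst (hd d) = 1"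
      using d by (auto simp: ocf_expansion_fin_def ocf_admissible_fin_iff_tail)
    show ?thesis
    proof (cases d)
      case Nil
      then have "real q = 3 * real p" using val 4 by (simp add: field_simps)
      then show ?thesis using 4 Nil
        by (intro exI[of _ "[(1, 3)]"]) (simp add: ocf_expansion_fin_def ocf_admissible_fin_iff_tail field_simps)
    next
      case (Cons c ds)
      obtain a where c: "c = (1, a)" using adm Cons by (cases c) auto
      have "1 / (real a + ocf_value ds) = 3 - real q / real p"
        using val 4 by (simp add: Cons c field_simps)
      moreover have "3 - real q / real p < 1" using 4 by (simp add: field_simps)
      ultimately have "ocf_expansion_fin (real p / real q) ((1, 3) # (-1, a) # ds)"
        using adm 4 by (auto simp: ocf_expansion_fin_def ocf_admissible_fin_iff_tail Cons c)
      then show ?thesis by blast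
    qed
  next
    case 5
    then have *: "q - 2 * p < q" "0 < q - 2 * p" "p \<le> q - 2 * p" by linarith+
    then obtain d where d: "ocf_expansion_fin (real p / real (q - 2 * p)) d"
      using less.IH[OF *] by blast
    have val: "ocf_value d = real p / (real q - 2 * real p)"
      using d 5 by (simp add: ocf_expansion_fin_def of_nat_diff)
    have adm: "ocf_tail d" "d \<noteq> [] \<longrightarrow> fst (hd d) = 1"
      using d by (auto simp: ocf_expansion_fin_def ocf_admissible_fin_iff_tail)
    have "real q - 2 * real p > 0" using 5 by linarith
    with val 5 have "ocf_value d \<noteq> 0" by simp
    then obtain c ds where dd: "d = c # ds" by (cases d) auto
    obtain a where c: "c = (1, a)" using adm dd by (cases c) auto
    have "1 / ocf_value d = (real q - 2 * real p) / real p" by (simp add: val)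
    also have "\<dots> = real q / real p - 2" using 5 by (simp add: field_simps)
    finally have "1 / ocf_value d = real q / real p - 2" .
    then have "real a + 2 + ocf_value ds = real q / real p" by (simp add: dd c)
    then have "1 / (real (a + 2) + ocf_value ds) = real p / real q" by (simp add: add_ac)
    then have "ocf_expansion_fin (real p / real q) ((1, a + 2) # ds)"
      using adm by (auto simp: ocf_expansion_fin_def ocf_admissible_fin_iff_tail dd c split: if_splits)
    then show ?thesis by blast
  qed
qed

lemma ocf_expansion_fin_exists:
  assumes "x \<in> \<rat>" "x \<in> {0..1}"
  shows "\<exists>d. ocf_expansion_fin x d"
proof -
  obtain p q where pq: "q \<noteq> 0" "\<bar>x\<bar> = real p / real q"
    using Rats_abs_nat_div_natE[OF assms(1)] by metis
  then have "x = real p / real q" using assms by simp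
  moreover from this pq have "p \<le> q" using assms by (simp add: divide_le_eq)
  ultimately show ?thesis using ocf_expansion_fin_exists_quotient[of q p] pq by simp
qed

section \<open>Infinite expansions\<close>

text \<open>
  As in \<open>ocf_tail\<close>, the first sign is arbitrary, so that tails of such sequences are again of this
  kind.
\<close>

definition ocf_tail_inf :: "(nat \<Rightarrow> ocf_digit) \<Rightarrow> bool" where
  "ocf_tail_inf d \<longleftrightarrow> (\<forall>i. fst (d i) \<in> {1, -1} \<and> odd (snd (d i))) \<and>
     (\<forall>i. int (snd (d i)) + fst (d (Suc i)) > 0)"

definition ocf_converges :: "(nat \<Rightarrow> ocf_digit) \<Rightarrow> real \<Rightarrow> bool" where
  "ocf_converges d x \<longleftrightarrow> (\<lambda>n. ocf_value (map d [0..<n])) \<longlonglongrightarrow> x"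

lemma ocf_expansion_inf_iff_tail:
  "ocf_expansion_inf x d \<longleftrightarrow> ocf_tail_inf d \<and> fst (d 0) = 1 \<and> ocf_converges d x"
  by (auto simp: ocf_expansion_inf_def ocf_admissible_inf_def ocf_tail_inf_def ocf_converges_def)

lemma ocf_tail_inf_case_nat:
  "ocf_tail_inf (case_nat (e, a) d) \<longleftrightarrow>
     e \<in> {1, -1} \<and> odd a \<and> int a + fst (d 0) > 0 \<and> ocf_tail_inf d"
proof -
  have all: "(\<forall>i. P i) \<longleftrightarrow> P 0 \<and> (\<forall>i. P (Suc i))" for P :: "nat \<Rightarrow> bool"
    by (metis not0_implies_Suc)
  show ?thesis unfolding ocf_tail_inf_def by (subst (1 2) all) auto
qed

lemma digit_seq_cases:
  obtains e a d' where "(d :: nat \<Rightarrow> ocf_digit) = case_nat (e, a) d'"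
proof
  show "d = case_nat (fst (d 0), snd (d 0)) (\<lambda>i. d (Suc i))"
    by (rule ext) (simp split: nat.split)
qed

lemma ocf_value_case_nat:
  "ocf_value (map (case_nat (e, a) d) [0..<Suc n]) = of_int e / (real a + ocf_value (map d [0..<n]))"
  by (simp add: map_upt_Suc del: upt_Suc)

text \<open>
  A truncation may end in \<open>(-1, 1)\<close> and then is not a legitimate finite expansion, so only the
  closed bound \<open>1\<close> survives. The sign is still the first sign of the sequence, and this suffices to
  keep the denominators \<open>a + t\<close> at least \<open>1\<close>.
\<close>

lemma ocf_truncation_bounds:
  "ocf_tail_inf d \<Longrightarrow> \<bar>ocf_value (map d [0..<n])\<bar> \<le> 1 \<and>
     (n > 0 \<longrightarrow> sgn (ocf_value (map d [0..<n])) = of_int (fst (d 0)))"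
proof (induction n arbitrary: d)
  case (Suc n)
  obtain e a d' where d: "d = case_nat (e, a) d'" by (rule digit_seq_cases)
  have prems: "e = 1 \<or> e = -1" "odd a" "int a + fst (d' 0) > 0" "ocf_tail_inf d'"
    using Suc.prems by (auto simp: d ocf_tail_inf_case_nat)
  define s where "s = ocf_value (map d' [0..<n])"
  have IH: "\<bar>s\<bar> \<le> 1" "n > 0 \<Longrightarrow> sgn s = of_int (fst (d' 0))"
    using Suc.IH[OF prems(4)] by (auto simp: s_def)
  have "real a + s \<ge> 1"
  proof (cases "a = 1")
    case True
    have "fst (d' 0) \<in> {1, -1}" using prems(4) by (simp add: ocf_tail_inf_def)
    then have "fst (d' 0) = 1" using prems(3) True by auto
    then have "s \<ge> 0" using IH(2) by (cases "n = 0") (auto simp: s_def sgn_1_pos)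
    then show ?thesis using True by simp
  next
    case False
    with prems(2) have "a \<ge> 3" by (auto elim!: oddE)
    then have "real a \<ge> 3" by simp
    then show ?thesis using IH(1) by linarith
  qed
  moreover have "ocf_value (map d [0..<Suc n]) = of_int e / (real a + s)"
    unfolding d ocf_value_case_nat s_def ..
  ultimately show ?case using prems(1) by (auto simp: d)
qed simp

lemma ocf_converges_bounds:
  assumes "ocf_tail_inf d" "ocf_converges d x" "x \<noteq> 0"
  shows "\<bar>x\<bar> \<le> 1" "sgn x = of_int (fst (d 0))"
proof -
  have lim: "(\<lambda>n. ocf_value (map d [0..<n])) \<longlonglongrightarrow> x"
    using assms(2) by (simp add: ocf_converges_def)
  show "\<bar>x\<bar> \<le> 1"
    by (rule LIMSEQ_le_const2[OF tendsto_rabs[OF lim]]) (use ocf_truncation_bounds[OF assms(1)] in blast)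
  have e: "fst (d 0) = 1 \<or> fst (d 0) = -1" using assms(1) by (auto simp: ocf_tail_inf_def)
  have "of_int (fst (d 0)) * x \<ge> 0"
  proof (rule LIMSEQ_le_const[OF tendsto_mult_left[OF lim]], intro exI[of _ 1] allI impI)
    fix n :: nat assume "1 \<le> n"
    then have "sgn (ocf_value (map d [0..<n])) = of_int (fst (d 0))"
      using ocf_truncation_bounds[OF assms(1), of n] by simp
    then show "0 \<le> of_int (fst (d 0)) * ocf_value (map d [0..<n])"
      by (metis abs_ge_zero abs_sgn mult.commute)
  qed
  then show "sgn x = of_int (fst (d 0))" using e assms(3) by auto
qed

text \<open>
  Convergence passes between a digit sequence and its tail in both directions, since each value is
  a continuous function of the other. Hence limits can be peeled digit by digit, as values of lists
  are.
\<close>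

lemma ocf_converges_case_nat:
  assumes "ocf_converges d y" "real a + y \<noteq> 0"
  shows "ocf_converges (case_nat (e, a) d) (of_int e / (real a + y))"
proof -
  have "(\<lambda>n. of_int e / (real a + ocf_value (map d [0..<n]))) \<longlonglongrightarrow> of_int e / (real a + y)"
    using assms unfolding ocf_converges_def by (intro tendsto_intros)
  then show ?thesis
    unfolding ocf_converges_def by - (rule LIMSEQ_imp_Suc, simp only: ocf_value_case_nat)
qed

lemma ocf_converges_tail:
  assumes "ocf_converges (case_nat (e, a) d) x" "x \<noteq> 0" "e \<noteq> 0"
  shows "ocf_converges d (of_int e / x - real a)"
proof -
  \<comment> \<open>The tail is recovered from the value by inverting \<open>t \<mapsto> e / (a + t)\<close>.\<close>
  have "(\<lambda>n. of_int e / (real a + ocf_value (map d [0..<n]))) \<longlonglongrightarrow> x"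
    using LIMSEQ_Suc[OF assms(1)[unfolded ocf_converges_def]] by (simp only: ocf_value_case_nat)
  from tendsto_diff[OF tendsto_divide[OF tendsto_const this assms(2)] tendsto_const]
  have "(\<lambda>n. of_int e / (of_int e / (real a + ocf_value (map d [0..<n]))) - real a)
    \<longlonglongrightarrow> of_int e / x - real a" .
  then show ?thesis using assms(3) by (simp add: ocf_converges_def)
qed

lemma irrational_ocf_step:
  assumes "x \<notin> \<rat>" "e = 1 \<or> e = (-1::int)"
  shows "of_int e / x - real a \<notin> \<rat>"
proof
  assume "of_int e / x - real a \<in> \<rat>"
  then have "of_int e / (real a + (of_int e / x - real a)) \<in> \<rat>"
    by (intro Rats_divide Rats_add) auto
  then show False using assms by auto
qed

text \<open>
  The limits of the tails lie in \<open>[-1, 1]\<close> and are irrational, hence in the open interval, where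
  the parity argument for finite expansions applies again.
\<close>

lemma ocf_converges_inj:
  assumes "ocf_tail_inf d" "ocf_tail_inf d'" "ocf_converges d x" "ocf_converges d' x" "x \<notin> \<rat>"
  shows "d i = d' i"
  using assms
proof (induction i arbitrary: d d' x rule: less_induct)
  case (less i)
  obtain e a c where d: "d = case_nat (e, a) c" by (rule digit_seq_cases)
  obtain e' a' c' where d': "d' = case_nat (e', a') c'" by (rule digit_seq_cases)
  have x: "x \<noteq> 0" using less.prems by auto
  have c: "e = 1 \<or> e = -1" "odd a" "ocf_tail_inf c" and c': "odd a'" "ocf_tail_inf c'"
    using less.prems(1,2) by (auto simp: d d' ocf_tail_inf_case_nat)
  have "sgn x = of_int e" "sgn x = of_int e'"
    using ocf_converges_bounds(2)[OF less.prems(1,3) x] ocf_converges_bounds(2)[OF less.prems(2,4) x]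
    by (simp_all add: d d')
  then have e: "e' = e" by simp
  define y where "y = of_int e / x - real a"
  define y' where "y' = of_int e / x - real a'"
  have irr: "y \<notin> \<rat>" "y' \<notin> \<rat>"
    using irrational_ocf_step[OF less.prems(5) c(1)] by (simp_all add: y_def y'_def)
  have conv: "ocf_converges c y" "ocf_converges c' y'"
    unfolding y_def y'_def using less.prems(3,4) x c(1)
    by (auto intro!: ocf_converges_tail simp: d d' e)
  have "\<bar>y\<bar> \<le> 1" "\<bar>y'\<bar> \<le> 1"
    using ocf_converges_bounds(1)[OF c(3) conv(1) irrational_nonzero[OF irr(1)]]
      ocf_converges_bounds(1)[OF c'(2) conv(2) irrational_nonzero[OF irr(2)]] by auto
  moreover have "\<bar>y\<bar> \<noteq> 1" "\<bar>y'\<bar> \<noteq> 1" using irr by (auto simp: abs_if split: if_splits)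
  ultimately have "\<bar>y - y'\<bar> < 2" by linarith
  then have a: "a = a'"
    using c(2) c'(1) by (intro odd_add_cancel[of a a' y y']) (simp_all add: y_def y'_def)
  then have "y' = y" by (simp add: y_def y'_def)
  then have "c j = c' j" if "j < i" for j
    using less.IH[OF that c(3) c'(2) conv(1)] conv(2) irr by simp
  then show ?case using e a by (cases i) (simp_all add: d d')
qed

lemma QO_irrational:
  assumes "x \<notin> \<rat>" "ocf_expansion_inf x d"
  shows "ocf_partial d \<longlonglongrightarrow> QO x"
proof -
  have "(THE d. ocf_expansion_inf x d) = d"
    using assms ocf_converges_inj by (intro the_equality) (auto simp: ocf_expansion_inf_iff_tail)
  then have "QO x = - (\<Sum>k. QO_term d k)" using assms(1) by (simp add: QO_def)
  then show ?thesis using ocf_partial_tendsto assms(2) by (simp add: ocf_expansion_inf_def)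
qed

text \<open>
  The map \<open>t \<mapsto> e / (a + t)\<close> need not contract the usual distance: for \<open>a = 1\<close> its derivative at
  \<open>0\<close> has modulus \<open>1\<close>. After weighting by \<open>1 / ((1 + |s|) (1 + |t|))\<close> it does, uniformly in the
  digit, because with \<open>A = a + t\<close> the image satisfies \<open>1 + 1/A = (A + 1)/A\<close> and
  \<open>A + 1 \<ge> 3/2 (1 + |t|)\<close>.
\<close>

lemma ocf_map_contracts:
  fixes s t :: real
  assumes "e = 1 \<or> e = (-1::int)" "odd a" "\<bar>s\<bar> \<le> 1" "\<bar>t\<bar> \<le> 1" "a = 1 \<Longrightarrow> s \<ge> 0 \<and> t \<ge> 0"
  defines "s' \<equiv> of_int e / (real a + s)" and "t' \<equiv> of_int e / (real a + t)"
  shows "\<bar>s' - t'\<bar> / ((1 + \<bar>s'\<bar>) * (1 + \<bar>t'\<bar>)) \<le> 4 / 9 * (\<bar>s - t\<bar> / ((1 + \<bar>s\<bar>) * (1 + \<bar>t\<bar>)))"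
proof -
  define A where "A = real a + s"
  define B where "B = real a + t"
  have *: "real a + u > 0 \<and> 3 / 2 * (1 + \<bar>u\<bar>) \<le> real a + u + 1"
    if "\<bar>u\<bar> \<le> 1" "a = 1 \<Longrightarrow> u \<ge> 0" for u
  proof (cases "a = 1")
    case False
    with assms(2) have "a \<ge> 3" by (auto elim!: oddE)
    then have "real a \<ge> 3" by simp
    then show ?thesis using that by (auto simp: abs_if)
  qed (use that in auto)
  have A: "A > 0" "3 / 2 * (1 + \<bar>s\<bar>) \<le> A + 1" and B: "B > 0" "3 / 2 * (1 + \<bar>t\<bar>) \<le> B + 1"
    using *[of s] *[of t] assms(3-5) by (auto simp: A_def B_def)
  have "s' - t' = of_int e * (t - s) / (A * B)"
    using A(1) B(1) unfolding s'_def t'_def A_def[symmetric] B_def[symmetric]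
    by (simp add: field_simps) (simp add: A_def B_def algebra_simps)
  then have diff: "\<bar>s' - t'\<bar> = \<bar>s - t\<bar> / (A * B)"
    using assms(1) A(1) B(1) by (auto simp: abs_mult abs_divide)
  have ab: "1 + \<bar>s'\<bar> = (A + 1) / A" "1 + \<bar>t'\<bar> = (B + 1) / B"
    using assms(1) A(1) B(1) unfolding s'_def t'_def A_def[symmetric] B_def[symmetric]
    by (auto simp: field_simps)
  have "\<bar>s' - t'\<bar> / ((1 + \<bar>s'\<bar>) * (1 + \<bar>t'\<bar>)) = \<bar>s - t\<bar> / ((A + 1) * (B + 1))"
    unfolding diff ab using A(1) B(1) by simp
  also have "\<dots> \<le> \<bar>s - t\<bar> / ((3 / 2 * (1 + \<bar>s\<bar>)) * (3 / 2 * (1 + \<bar>t\<bar>)))"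
    using A B by (intro divide_left_mono mult_mono mult_pos_pos) auto
  also have "\<dots> = 4 / 9 * (\<bar>s - t\<bar> / ((1 + \<bar>s\<bar>) * (1 + \<bar>t\<bar>)))"
    by (simp del: distrib_left_numeral distrib_right_numeral)
  finally show ?thesis .
qed

text \<open>
  Here \<open>y i\<close> is the exact tail after \<open>i\<close> digits, and truncating replaces \<open>y n\<close> by \<open>0\<close>. Pulling
  the two values through \<open>n\<close> digits contracts their weighted distance \<open>n\<close> times.
\<close>

lemma ocf_truncation_error:
  assumes "ocf_tail_inf d" "\<And>i. y i = of_int (fst (d i)) / (real (snd (d i)) + y (Suc i))"
    "\<And>i. \<bar>y i\<bar> \<le> 1" "\<And>i. sgn (y i) = of_int (fst (d i))"
  shows "\<bar>y 0 - ocf_value (map d [0..<n])\<bar> /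
    ((1 + \<bar>y 0\<bar>) * (1 + \<bar>ocf_value (map d [0..<n])\<bar>)) \<le> (4 / 9) ^ n"
  using assms
proof (induction n arbitrary: d y)
  case 0
  show ?case by (simp add: divide_le_eq add_pos_nonneg)
next
  case (Suc n)
  obtain e a d' where d: "d = case_nat (e, a) d'" by (rule digit_seq_cases)
  have prems: "e = 1 \<or> e = -1" "odd a" "int a + fst (d' 0) > 0" "ocf_tail_inf d'"
    using Suc.prems(1) by (auto simp: d ocf_tail_inf_case_nat)
  define s where "s = ocf_value (map d' [0..<n])"
  have IH: "\<bar>y 1 - s\<bar> / ((1 + \<bar>y 1\<bar>) * (1 + \<bar>s\<bar>)) \<le> (4 / 9) ^ n"
    unfolding s_def One_nat_def
  proof (rule Suc.IH[OF prems(4), of "\<lambda>i. y (Suc i)"])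
    fix i
    show "y (Suc i) = of_int (fst (d' i)) / (real (snd (d' i)) + y (Suc (Suc i)))"
      using Suc.prems(2)[of "Suc i"] unfolding d nat.case .
    show "\<bar>y (Suc i)\<bar> \<le> 1" by (rule Suc.prems(3))
    show "sgn (y (Suc i)) = of_int (fst (d' i))"
      using Suc.prems(4)[of "Suc i"] unfolding d nat.case .
  qed
  have s: "\<bar>s\<bar> \<le> 1" "n > 0 \<Longrightarrow> sgn s = of_int (fst (d' 0))"
    using ocf_truncation_bounds[OF prems(4)] by (auto simp: s_def)
  have pos: "y 1 \<ge> 0 \<and> s \<ge> 0" if "a = 1"
  proof -
    have "fst (d' 0) \<in> {1, -1}" using prems(4) by (simp add: ocf_tail_inf_def)
    then have "fst (d' 0) = 1" using prems(3) that by auto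
    moreover from this have "sgn (y 1) = 1" using Suc.prems(4)[of 1] by (simp add: d)
    ultimately show ?thesis using s(2) by (cases "n = 0") (auto simp: s_def sgn_1_pos)
  qed
  have y0: "y 0 = of_int e / (real a + y 1)" using Suc.prems(2)[of 0] by (simp add: d)
  have v: "ocf_value (map d [0..<Suc n]) = of_int e / (real a + s)"
    unfolding d ocf_value_case_nat s_def ..
  note ocf_map_contracts[OF prems(1,2) Suc.prems(3)[of 1] s(1) pos]
  also have "4 / 9 * (\<bar>y 1 - s\<bar> / ((1 + \<bar>y 1\<bar>) * (1 + \<bar>s\<bar>))) \<le> 4 / 9 * (4 / 9) ^ n"
    by (intro mult_left_mono IH) simp
  finally show ?case unfolding y0 v power_Suc .
qed

text \<open>
  The odd integer within distance \<open>1\<close> of \<open>1 / |x|\<close>.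
\<close>

lemma ocf_digit_exists:
  assumes "x \<notin> \<rat>" "\<bar>x\<bar> < 1"
  shows "\<exists>y a. y \<notin> \<rat> \<and> \<bar>y\<bar> < 1 \<and> odd a \<and> (a = 1 \<longrightarrow> y > 0) \<and> x = sgn x / (real a + y)"
proof -
  have x: "x \<noteq> 0" using assms by auto
  define k where "k = nat \<lfloor>1 / (2 * \<bar>x\<bar>)\<rfloor>"
  define y where "y = 1 / \<bar>x\<bar> - real (2 * k + 1)"
  have "real k = of_int \<lfloor>1 / (2 * \<bar>x\<bar>)\<rfloor>" by (simp add: k_def)
  then have "real k \<le> 1 / (2 * \<bar>x\<bar>)" "1 / (2 * \<bar>x\<bar>) < real k + 1" by linarith+
  then have k: "2 * real k \<le> 1 / \<bar>x\<bar>" "1 / \<bar>x\<bar> < 2 * real k + 2"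
    using x by (auto simp: field_simps)
  have irr: "y \<notin> \<rat>"
    using irrational_ocf_step[of "\<bar>x\<bar>" 1 "2 * k + 1"] assms(1) by (auto simp: y_def abs_if)
  have "y \<ge> -1" "y < 1" using k by (auto simp: y_def)
  moreover have "y \<noteq> -1" using irr by auto
  moreover have "y > 0" if "2 * k + 1 = 1"
    using that assms x by (simp add: y_def field_simps)
  moreover have "x = sgn x / (real (2 * k + 1) + y)"
    using x by (simp add: y_def mult_sgn_abs mult.commute[of "\<bar>x\<bar>"])
  ultimately show ?thesis using irr by (intro exI[of _ y] exI[of _ "2 * k + 1"]) auto
qed

text \<open>
  The tails are chosen successively by \<open>ocf_digit_exists\<close>. The error estimate, with the weight
  bounded by \<open>2 * 2\<close>, shows that the resulting continued fraction converges to the given number.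
\<close>

lemma ocf_expansion_inf_exists:
  assumes "x \<notin> \<rat>" "x \<in> {0..1}"
  shows "\<exists>d. ocf_expansion_inf x d"
proof -
  define P where "P n t \<longleftrightarrow> t \<notin> \<rat> \<and> \<bar>t\<bar> < 1 \<and> (n = 0 \<longrightarrow> t = x)" for n :: nat and t
  define R where "R t u a \<longleftrightarrow> odd a \<and> (a = 1 \<longrightarrow> u > 0) \<and> t = sgn t / (real a + u)"
    for t u :: real and a :: nat
  have "x \<noteq> 0" "x \<noteq> 1" using assms by auto
  then have x: "x > 0" "x < 1" using assms(2) by auto
  have "\<exists>f. \<forall>n. P n (f n) \<and> (\<exists>a. R (f n) (f (Suc n)) a)"
  proof (rule dependent_nat_choice)
    show "\<exists>t. P 0 t" using assms x by (auto simp: P_def)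
    show "\<exists>u. P (Suc n) u \<and> (\<exists>a. R t u a)" if "P n t" for t n
      using ocf_digit_exists[of t] that unfolding P_def R_def by blast
  qed
  then obtain y where y: "\<And>n. P n (y n)" "\<And>n. \<exists>a. R (y n) (y (Suc n)) a" by blast
  then obtain a where a: "\<And>n. R (y n) (y (Suc n)) (a n)" by metis
  define d where "d n = (if y n > 0 then 1 else - 1 :: int, a n)" for n
  have y0: "y 0 = x" and yn: "\<And>n. y n \<noteq> 0" "\<And>n. \<bar>y n\<bar> \<le> 1"
    using y(1) irrational_nonzero by (auto simp: P_def less_imp_le)
  have sgn: "sgn (y n) = of_int (fst (d n))" for n using yn(1)[of n] by (auto simp: d_def)
  have "int (a i) + (if y (Suc i) > 0 then 1 else -1) > 0" for i
  proof -
    have "a i > 1 \<or> a i = 1" using a[of i] by (auto simp: R_def elim: oddE)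
    then show ?thesis using a[of i] by (auto simp: R_def)
  qed
  then have tail: "ocf_tail_inf d"
    using a unfolding ocf_tail_inf_def by (auto simp: d_def R_def)
  have rec: "y i = of_int (fst (d i)) / (real (snd (d i)) + y (Suc i))" for i
    unfolding sgn[symmetric] using a[of i] by (simp add: d_def R_def)
  have "\<bar>y 0 - ocf_value (map d [0..<n])\<bar> \<le> 4 * (4 / 9) ^ n" for n
  proof -
    define v where "v = ocf_value (map d [0..<n])"
    have "\<bar>v\<bar> \<le> 1" using ocf_truncation_bounds[OF tail] by (simp add: v_def)
    have "0 < (1 + \<bar>y 0\<bar>) * (1 + \<bar>v\<bar>)" by (intro mult_pos_pos) auto
    then have "\<bar>y 0 - v\<bar> \<le> (4 / 9) ^ n * ((1 + \<bar>y 0\<bar>) * (1 + \<bar>v\<bar>))"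
      using ocf_truncation_error[OF tail rec yn(2) sgn, of n]
      unfolding v_def[symmetric] by (simp only: pos_divide_le_eq)
    also have "\<dots> \<le> (4 / 9) ^ n * (2 * 2)"
      using \<open>\<bar>v\<bar> \<le> 1\<close> yn(2)[of 0] by (intro mult_left_mono mult_mono) auto
    finally have "\<bar>y 0 - v\<bar> \<le> 4 * (4 / 9) ^ n" by simp
    then show ?thesis by (simp add: v_def)
  qed
  then have bound: "norm (ocf_value (map d [0..<n]) - x) \<le> 4 * (4 / 9) ^ n" for n
    unfolding y0 by (simp add: abs_minus_commute)
  have "(\<lambda>n. 4 * (4 / 9 :: real) ^ n) \<longlonglongrightarrow> 0"
    by (intro tendsto_mult_right_zero LIMSEQ_power_zero) simp
  then have "(\<lambda>n. ocf_value (map d [0..<n]) - x) \<longlonglongrightarrow> 0"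
    by (rule Lim_null_comparison[rotated]) (intro always_eventually allI bound)
  then have "ocf_converges d x" unfolding ocf_converges_def by (simp add: LIM_zero_iff)
  moreover have "fst (d 0) = 1" using x y0 by (simp add: d_def)
  ultimately show ?thesis using tail by (auto simp: ocf_expansion_inf_iff_tail)
qed

lemma abs_QO_le:
  assumes "x \<in> {0..1}"
  shows "\<bar>QO x\<bar> \<le> ocf_lambda / (ocf_lambda - 1)"
proof (cases "x \<in> \<rat>")
  case True
  then obtain d where d: "ocf_expansion_fin x d" using ocf_expansion_fin_exists assms by blast
  then show ?thesis unfolding QO_rational[OF True d]
    by (intro abs_ocf_partial_le) (auto simp: ocf_expansion_fin_def ocf_admissible_fin_def)
next
  case False
  then obtain d where d: "ocf_expansion_inf x d" using ocf_expansion_inf_exists assms by blast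
  show ?thesis
    by (rule LIMSEQ_le_const2[OF tendsto_rabs[OF QO_irrational[OF False d]]])
       (use d in \<open>auto intro!: abs_ocf_partial_le simp: ocf_expansion_inf_def ocf_admissible_inf_def\<close>)
qed

section \<open>The self-similarity of the function\<close>

lemma irrational_reciprocal:
  fixes z :: real
  assumes "r \<in> \<rat>" "z \<notin> \<rat>"
  shows "1 / (r + z) \<notin> \<rat>"
proof
  assume "1 / (r + z) \<in> \<rat>"
  from Rats_diff[OF Rats_inverse[OF this] assms(1)] show False using assms(2) by simp
qed

lemma ocf_partial_negate:
  assumes "odd a" "n > 0 \<Longrightarrow> odd (snd (d 0))"
  shows "ocf_partial (case_nat (- e, a) d) (Suc n) = - ocf_partial (case_nat (e, a) d) (Suc n)"
  using assms odd_pos by (subst (1 2) ocf_partial_case_nat) (auto simp: Suc_le_eq)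

lemma ocf_partial_raise:
  assumes "odd a" "n > 0 \<Longrightarrow> odd (snd (d 0))"
  shows "ocf_partial (case_nat (e, a + 2) d) (Suc n)
    = ocf_partial (case_nat (e, a) d) (Suc n) / ocf_lambda ^ 2"
  using assms odd_pos by (subst (1 2) ocf_partial_case_nat) (auto simp: Suc_le_eq power2_eq_square)

lemma QO_rational_Cons:
  assumes "x \<in> \<rat>" "ocf_tail ((1, a) # ds)" "x = 1 / (real a + ocf_value ds)"
  shows "QO x = ocf_partial (case_nat (1, a) ((!) ds)) (Suc (length ds))"
  using QO_rational[of x "(1, a) # ds"] assms
  by (simp add: ocf_expansion_fin_def ocf_admissible_fin_iff_tail nth_Cons_fun)

lemma rational_ocf_cases:
  assumes "y \<in> \<rat>" "y \<in> {0..1}"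
  obtains "y = 0" "QO y = 0"
  | a ds where "ocf_tail ((1, a) # ds)" "y = 1 / (real a + ocf_value ds)" "y \<noteq> 0"
      "QO y = ocf_partial (case_nat (1, a) ((!) ds)) (Suc (length ds))"
proof -
  obtain d where d: "ocf_expansion_fin y d" using ocf_expansion_fin_exists[OF assms] by blast
  show thesis
  proof (cases d)
    case Nil
    then show thesis
      using d QO_rational[OF assms(1) d] that(1) by (simp add: ocf_expansion_fin_def ocf_partial_def)
  next
    case (Cons c ds)
    obtain a where c: "c = (1, a)"
      using d Cons by (cases c) (auto simp: ocf_expansion_fin_def ocf_admissible_fin_iff_tail)
    have tail: "ocf_tail ((1, a) # ds)" and y: "y = 1 / (real a + ocf_value ds)"
      using d by (auto simp: ocf_expansion_fin_def ocf_admissible_fin_iff_tail Cons c)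
    have "y \<noteq> 0" using ocf_tail_value_bounds[OF tail] y by simp
    then show thesis using that(2) tail y QO_rational_Cons[OF assms(1) tail y] by blast
  qed
qed

lemma ocf_tail_nth_odd: "ocf_tail ds \<Longrightarrow> length ds > 0 \<Longrightarrow> odd (snd (ds ! 0))"
  by (simp add: ocf_tail_iff)

lemma irrational_ocf_cases:
  assumes "y \<notin> \<rat>" "y \<in> {0..1}"
  obtains a c z where "ocf_tail_inf (case_nat (1, a) c)" "ocf_converges c z" "z \<notin> \<rat>" "\<bar>z\<bar> \<le> 1"
      "y = 1 / (real a + z)" "ocf_converges (case_nat (1, a) c) y"
      "(\<lambda>n. ocf_partial (case_nat (1, a) c) (Suc n)) \<longlonglongrightarrow> QO y"
proof -
  obtain d where d: "ocf_expansion_inf y d" using ocf_expansion_inf_exists[OF assms] by blast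
  obtain e a c where c: "d = case_nat (e, a) c" by (rule digit_seq_cases)
  have e: "e = 1" using d by (simp add: ocf_expansion_inf_iff_tail c)
  have tail: "ocf_tail_inf (case_nat (1, a) c)" and conv: "ocf_converges (case_nat (1, a) c) y"
    using d by (auto simp: ocf_expansion_inf_iff_tail c e)
  define z where "z = 1 / y - real a"
  have y: "y \<noteq> 0" using assms by auto
  have z: "z \<notin> \<rat>" using irrational_ocf_step[OF assms(1), of 1 a] by (simp add: z_def)
  have "ocf_converges c z" using ocf_converges_tail[OF conv y] by (simp add: z_def)
  moreover have "\<bar>z\<bar> \<le> 1"
    using ocf_converges_bounds(1)[of c z] tail calculation z irrational_nonzero[OF z] by (auto simp: ocf_tail_inf_case_nat)
  moreover have "y = 1 / (real a + z)" using y by (simp add: z_def)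
  moreover have "(\<lambda>n. ocf_partial (case_nat (1, a) c) (Suc n)) \<longlonglongrightarrow> QO y"
    using LIMSEQ_Suc[OF QO_irrational[OF assms(1) d]] by (simp add: c e)
  ultimately show thesis using that tail conv z by blast
qed

lemma QO_irrational_case_nat:
  assumes "x \<notin> \<rat>" "ocf_tail_inf (case_nat (1, a) c)" "ocf_converges (case_nat (1, a) c) x"
  shows "(\<lambda>n. ocf_partial (case_nat (1, a) c) (Suc n)) \<longlonglongrightarrow> QO x"
  using LIMSEQ_Suc[OF QO_irrational[of x "case_nat (1, a) c"]] assms
  by (simp add: ocf_expansion_inf_iff_tail)

lemma ocf_tail_inf_odd: "ocf_tail_inf d \<Longrightarrow> odd (snd (d i))"
  by (simp add: ocf_tail_inf_def)

lemma QO_0: "QO 0 = 0"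
  using QO_rational[of 0 "[]"]
  by (simp add: ocf_expansion_fin_def ocf_admissible_fin_iff_tail ocf_partial_def)

text \<open>
  The three equations that follow express that \<open>[0, 1]\<close> splits into the images of the maps
  \<open>1 / (1 + y)\<close>, \<open>y / (1 + 2y)\<close> and \<open>1 / (3 - y)\<close>, on each of which the function is an affine copy
  of itself, scaled by \<open>\<lambda>\<^sup>-\<^sup>1\<close>, \<open>\<lambda>\<^sup>-\<^sup>2\<close> and \<open>\<lambda>\<^sup>-\<^sup>3\<close>. The first map prepends the digit \<open>(1, 1)\<close>.
\<close>

lemma QO_invert:
  assumes "y \<in> {0..1}"
  shows "QO (1 / (1 + y)) = 1 - QO y / ocf_lambda"
proof (cases "y \<in> \<rat>")
  case True
  obtain d where d: "ocf_expansion_fin y d" using ocf_expansion_fin_exists[OF True assms] by blast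
  have tail: "ocf_tail d" "d \<noteq> [] \<Longrightarrow> fst (hd d) = 1" and y: "ocf_value d = y"
    using d by (auto simp: ocf_expansion_fin_def ocf_admissible_fin_iff_tail)
  have "1 / (1 + y) \<in> \<rat>" using True by simp
  then have "QO (1 / (1 + y)) = ocf_partial (case_nat (1, 1) ((!) d)) (Suc (length d))"
    using tail y by (intro QO_rational_Cons) auto
  also have "\<dots> = (ocf_lambda - ocf_partial ((!) d) (length d)) / ocf_lambda"
    using ocf_tail_nth_odd[OF tail(1)] odd_pos by (subst ocf_partial_case_nat) (auto simp: Suc_le_eq)
  also have "\<dots> = 1 - QO y / ocf_lambda"
    using ocf_lambda_gt_1 by (simp add: QO_rational[OF True d] diff_divide_distrib)
  finally show ?thesis .
next
  case False
  obtain d where d: "ocf_expansion_inf y d" using ocf_expansion_inf_exists[OF False assms] by blast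
  have tail: "ocf_tail_inf d" "fst (d 0) = 1" and conv: "ocf_converges d y"
    using d by (auto simp: ocf_expansion_inf_iff_tail)
  have "1 / (1 + y) \<notin> \<rat>" using False by (intro irrational_reciprocal) auto
  moreover have "ocf_converges (case_nat (1, 1) d) (1 / (1 + y))"
    using ocf_converges_case_nat[OF conv, of 1 1] assms by simp
  moreover have "ocf_tail_inf (case_nat (1, 1) d)"
    using tail by (simp add: ocf_tail_inf_case_nat)
  ultimately have "(\<lambda>n. ocf_partial (case_nat (1, 1) d) (Suc n)) \<longlonglongrightarrow> QO (1 / (1 + y))"
    by (intro QO_irrational_case_nat)
  moreover have "ocf_partial (case_nat (1, 1) d) (Suc n) = (ocf_lambda - ocf_partial d n) / ocf_lambda" for n
    using ocf_tail_inf_odd[OF tail(1), of 0] odd_pos by (subst ocf_partial_case_nat) (auto simp: Suc_le_eq)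
  ultimately have "(\<lambda>n. (ocf_lambda - ocf_partial d n) / ocf_lambda) \<longlonglongrightarrow> QO (1 / (1 + y))"
    by simp
  moreover have "(\<lambda>n. (ocf_lambda - ocf_partial d n) / ocf_lambda) \<longlonglongrightarrow> (ocf_lambda - QO y) / ocf_lambda"
    using ocf_lambda_gt_1 by (intro tendsto_intros QO_irrational[OF False d]) auto
  ultimately have "QO (1 / (1 + y)) = (ocf_lambda - QO y) / ocf_lambda"
    by (rule LIMSEQ_unique)
  then show ?thesis using ocf_lambda_gt_1 by (simp add: diff_divide_distrib)
qed

lemma QO_1: "QO 1 = 1"
  using QO_invert[of 0] by (simp add: QO_0)

lemma QO_half: "QO (1 / 2) = 1 - 1 / ocf_lambda"
  using QO_invert[of 1] by (simp add: QO_1)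

text \<open>
  The map \<open>y / (1 + 2y)\<close> adds \<open>2\<close> to \<open>1/y\<close>, that is, to the first partial quotient.
\<close>

lemma QO_parabolic:
  assumes "y \<in> {0..1}"
  shows "QO (y / (1 + 2 * y)) = QO y / ocf_lambda ^ 2"
proof (cases "y \<in> \<rat>")
  case True
  from rational_ocf_cases[OF True assms] show ?thesis
  proof cases
    case 1
    then show ?thesis by (simp add: QO_0)
  next
    case (2 a ds)
    have "y / (1 + 2 * y) \<in> \<rat>" using True by (intro Rats_divide Rats_add Rats_mult) auto
    moreover have "y / (1 + 2 * y) = 1 / (real (a + 2) + ocf_value ds)"
    proof -
      have "y / (1 + 2 * y) = 1 / (1 / y + 2)" using \<open>y \<noteq> 0\<close> assms by (simp add: field_simps)
      also have "1 / y = real a + ocf_value ds" by (simp add: 2(2))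
      finally show ?thesis by (simp add: add_ac)
    qed
    moreover have "ocf_tail ((1, a + 2) # ds)" using 2(1) by (auto split: if_splits)
    ultimately have "QO (y / (1 + 2 * y)) = ocf_partial (case_nat (1, a + 2) ((!) ds)) (Suc (length ds))"
      by (intro QO_rational_Cons)
    also have "\<dots> = QO y / ocf_lambda ^ 2"
      using 2(1) ocf_tail_nth_odd[of ds] unfolding 2(4) by (intro ocf_partial_raise) auto
    finally show ?thesis .
  qed
next
  case False
  from irrational_ocf_cases[OF False assms] obtain a c z where
    y: "ocf_tail_inf (case_nat (1, a) c)" "ocf_converges c z" "z \<notin> \<rat>" "\<bar>z\<bar> \<le> 1"
      "y = 1 / (real a + z)" "ocf_converges (case_nat (1, a) c) y"
      "(\<lambda>n. ocf_partial (case_nat (1, a) c) (Suc n)) \<longlonglongrightarrow> QO y" by blast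
  have y0: "y \<noteq> 0" using False by auto
  have eq: "y / (1 + 2 * y) = 1 / (real (a + 2) + z)"
  proof -
    have "y / (1 + 2 * y) = 1 / (1 / y + 2)" using y0 assms by (simp add: field_simps)
    also have "1 / y = real a + z" by (simp add: y(5))
    finally show ?thesis by (simp add: add_ac)
  qed
  have "y / (1 + 2 * y) \<notin> \<rat>" unfolding eq using y(3) by (intro irrational_reciprocal) auto
  moreover have "ocf_converges (case_nat (1, a + 2) c) (y / (1 + 2 * y))"
    using ocf_converges_case_nat[OF y(2), of "a + 2" 1] y(4) unfolding eq by simp
  moreover have "ocf_tail_inf (case_nat (1, a + 2) c)"
    using y(1) by (simp add: ocf_tail_inf_case_nat)
  ultimately have "(\<lambda>n. ocf_partial (case_nat (1, a + 2) c) (Suc n)) \<longlonglongrightarrow> QO (y / (1 + 2 * y))"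
    by (intro QO_irrational_case_nat)
  moreover have "ocf_partial (case_nat (1, a + 2) c) (Suc n)
      = ocf_partial (case_nat (1, a) c) (Suc n) / ocf_lambda ^ 2" for n
    using y(1) by (intro ocf_partial_raise) (auto simp: ocf_tail_inf_case_nat ocf_tail_inf_odd)
  ultimately have "(\<lambda>n. ocf_partial (case_nat (1, a) c) (Suc n) / ocf_lambda ^ 2)
      \<longlonglongrightarrow> QO (y / (1 + 2 * y))" by simp
  moreover have "(\<lambda>n. ocf_partial (case_nat (1, a) c) (Suc n) / ocf_lambda ^ 2)
      \<longlonglongrightarrow> QO y / ocf_lambda ^ 2"
    using ocf_lambda_gt_1 by (intro tendsto_intros y(7)) auto
  ultimately show ?thesis by (rule LIMSEQ_unique)
qed

text \<open>
  Since \<open>-y\<close> has the digits of \<open>y\<close> with the first sign negated, \<open>1 / (3 - y)\<close> is obtained by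
  prepending \<open>(1, 3)\<close> to these.
\<close>

lemma QO_middle:
  assumes "y \<in> {0..1}"
  shows "QO (1 / (3 - y)) = (ocf_lambda + QO y) / ocf_lambda ^ 3"
proof (cases "y \<in> \<rat>")
  case True
  have rat: "1 / (3 - y) \<in> \<rat>" using True by simp
  show ?thesis
  \<comment> \<open>At \<open>y = 1\<close> negating the sign would create the forbidden last digit \<open>(-1, 1)\<close>.\<close>
  proof (cases "y = 1")
    case True
    have "(ocf_lambda + 1) / ocf_lambda ^ 3 = (ocf_lambda ^ 3 - ocf_lambda ^ 2) / ocf_lambda ^ 3"
      using ocf_lambda_cubic by simp
    also have "\<dots> = QO (1 / 2)"
      using ocf_lambda_gt_1 unfolding QO_half by (simp add: field_simps power2_eq_square power3_eq_cube)
    finally show ?thesis by (simp add: True QO_1)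
  next
    case y1: False
    from rational_ocf_cases[OF True assms] show ?thesis
    proof cases
      case 1
      have "QO (1 / (3 - y)) = ocf_partial (case_nat (1, 3) ((!) [])) (Suc (length ([] :: ocf_digit list)))"
        using 1 rat by (intro QO_rational_Cons) auto
      also have "\<dots> = ocf_lambda / ocf_lambda ^ 3"
        by (subst ocf_partial_case_nat) (auto simp: ocf_partial_def)
      finally show ?thesis using 1 by simp
    next
      case (2 a ds)
      have "ocf_value ((-1, a) # ds) = - y" using 2(2) by simp
      moreover have "ocf_tail ((1, 3) # (-1, a) # ds)"
        using 2(1,2) y1 by (auto split: if_splits)
      ultimately have "QO (1 / (3 - y)) =
          ocf_partial (case_nat (1, 3) ((!) ((-1, a) # ds))) (Suc (length ((-1, a) # ds)))"
        using rat by (intro QO_rational_Cons) auto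
      also have "\<dots> = (ocf_lambda - ocf_partial (case_nat (-1, a) ((!) ds)) (Suc (length ds))) / ocf_lambda ^ 3"
        using 2(1) odd_pos by (subst ocf_partial_case_nat) (auto simp: nth_Cons_fun Suc_le_eq)
      also have "ocf_partial (case_nat (-1, a) ((!) ds)) (Suc (length ds)) = - QO y"
        using 2(1) ocf_tail_nth_odd[of ds] unfolding 2(4) by (intro ocf_partial_negate) auto
      finally show ?thesis by simp
    qed
  qed
next
  case False
  from irrational_ocf_cases[OF False assms] obtain a c z where
    y: "ocf_tail_inf (case_nat (1, a) c)" "ocf_converges c z" "z \<notin> \<rat>" "\<bar>z\<bar> \<le> 1"
      "y = 1 / (real a + z)" "ocf_converges (case_nat (1, a) c) y"
      "(\<lambda>n. ocf_partial (case_nat (1, a) c) (Suc n)) \<longlonglongrightarrow> QO y" by blast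
  define c' where "c' = case_nat (-1, a) c"
  have "1 / (3 - y) \<notin> \<rat>" using False irrational_reciprocal[of 3 "- y"] by simp
  moreover have "ocf_converges (case_nat (1, 3) c') (1 / (3 - y))"
  proof -
    have "real a + z \<noteq> 0" using False y(5) by auto
    then have "ocf_converges c' (- y)"
      using ocf_converges_case_nat[OF y(2), of a "-1"] by (simp add: c'_def y(5))
    from ocf_converges_case_nat[OF this, of 3 1] show ?thesis using assms by simp
  qed
  moreover have tail: "ocf_tail_inf (case_nat (1, 3) c')" "odd a"
    using y(1) by (auto simp: ocf_tail_inf_case_nat c'_def)
  ultimately have "(\<lambda>n. ocf_partial (case_nat (1, 3) c') (Suc n)) \<longlonglongrightarrow> QO (1 / (3 - y))"
    by (intro QO_irrational_case_nat)
  from LIMSEQ_Suc[OF this]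
  have "(\<lambda>n. ocf_partial (case_nat (1, 3) c') (Suc (Suc n))) \<longlonglongrightarrow> QO (1 / (3 - y))" .
  moreover have "ocf_partial (case_nat (1, 3) c') (Suc (Suc n))
      = (ocf_lambda + ocf_partial (case_nat (1, a) c) (Suc n)) / ocf_lambda ^ 3" for n
  proof -
    have "ocf_partial c' (Suc n) = - ocf_partial (case_nat (1, a) c) (Suc n)"
      using y(1) unfolding c'_def
      by (intro ocf_partial_negate) (auto simp: ocf_tail_inf_case_nat ocf_tail_inf_odd)
    then show ?thesis
      using tail(2) odd_pos[of a] by (subst ocf_partial_case_nat) (auto simp: c'_def Suc_le_eq)
  qed
  ultimately have "(\<lambda>n. (ocf_lambda + ocf_partial (case_nat (1, a) c) (Suc n)) / ocf_lambda ^ 3)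
      \<longlonglongrightarrow> QO (1 / (3 - y))" by simp
  moreover have "(\<lambda>n. (ocf_lambda + ocf_partial (case_nat (1, a) c) (Suc n)) / ocf_lambda ^ 3)
      \<longlonglongrightarrow> (ocf_lambda + QO y) / ocf_lambda ^ 3"
    using ocf_lambda_gt_1 by (intro tendsto_intros y(7)) auto
  ultimately show ?thesis by (rule LIMSEQ_unique)
qed

text \<open>
  The index is the number by which the branch raises the sum of the partial quotients of a generic
  point; it is also the exponent of \<open>1/\<lambda>\<close> in the scaling of the function.
\<close>

definition ocf_branch :: "nat \<Rightarrow> real \<Rightarrow> real" where
  "ocf_branch k y = (if k = 1 then 1 / (1 + y) else if k = 2 then y / (1 + 2 * y) else 1 / (3 - y))"

lemma ocf_branch_unit: "k \<in> {1, 2, 3} \<Longrightarrow> y \<in> {0..1} \<Longrightarrow> ocf_branch k y \<in> {0..1}"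
  by (auto simp: ocf_branch_def divide_le_eq)

lemma ocf_branch_1_surj: "x \<in> {1/2..1} \<Longrightarrow> \<exists>y\<in>{0..1}. ocf_branch 1 y = x"
  by (rule bexI[of _ "1 / x - 1"]) (auto simp: ocf_branch_def field_simps)

lemma ocf_branch_2_surj: "x \<in> {0..1/3} \<Longrightarrow> \<exists>y\<in>{0..1}. ocf_branch 2 y = x"
  by (rule bexI[of _ "x / (1 - 2 * x)"]) (auto simp: ocf_branch_def field_simps)

lemma ocf_branch_3_surj: "x \<in> {1/3..1/2} \<Longrightarrow> \<exists>y\<in>{0..1}. ocf_branch 3 y = x"
  by (rule bexI[of _ "3 - 1 / x"]) (auto simp: ocf_branch_def field_simps)

lemma abs_QO_branch_diff:
  assumes "k \<in> {1, 2, 3}" "x \<in> {0..1}" "y \<in> {0..1}"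
  shows "\<bar>QO (ocf_branch k x) - QO (ocf_branch k y)\<bar> = \<bar>QO x - QO y\<bar> / ocf_lambda ^ k"
proof -
  have "QO (ocf_branch k x) - QO (ocf_branch k y) = (if k = 1 then - 1 else 1) * (QO x - QO y) / ocf_lambda ^ k"
    using assms ocf_lambda_gt_1
    by (auto simp: ocf_branch_def QO_invert QO_parabolic QO_middle diff_divide_distrib add_divide_distrib)
  then show ?thesis using ocf_lambda_gt_1 by (simp add: abs_mult)
qed

section \<open>A distance adapted to the three branches\<close>

text \<open>
  Equal to \<open>|x - y| / ((G + x) (G + y))\<close> on the unit interval, so comparable with \<open>|x - y|\<close> there.
  The coordinate \<open>1 / (G + x)\<close> sends the fixed point \<open>-G\<close> of the map \<open>1 / (1 + x)\<close> to infinity, so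
  in this coordinate that map is affine; its slope is \<open>-1 / G\<^sup>2\<close>.
\<close>

definition golden_dist :: "real \<Rightarrow> real \<Rightarrow> real" where
  "golden_dist x y = \<bar>1 / (golden_ratio + x) - 1 / (golden_ratio + y)\<bar>"

lemma golden_dist_sym: "golden_dist x y = golden_dist y x"
  by (simp add: golden_dist_def abs_minus_commute)

lemma golden_dist_nonneg [simp]: "golden_dist x y \<ge> 0"
  by (simp add: golden_dist_def)

lemma moebius_abs_diff:
  fixes c d p q x y :: real
  assumes "p + q * x \<noteq> 0" "p + q * y \<noteq> 0"
  shows "\<bar>(c + d * x) / (p + q * x) - (c + d * y) / (p + q * y)\<bar>
    = \<bar>d * p - c * q\<bar> * \<bar>x - y\<bar> / \<bar>(p + q * x) * (p + q * y)\<bar>"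
proof -
  have "(c + d * x) / (p + q * x) - (c + d * y) / (p + q * y)
    = (d * p - c * q) * (x - y) / ((p + q * x) * (p + q * y))"
    using assms by (simp add: diff_frac_eq) (simp add: algebra_simps)
  then show ?thesis by (simp only: abs_mult abs_divide)
qed

lemma golden_dist_eq:
  assumes "x \<ge> 0" "y \<ge> 0"
  shows "golden_dist x y = \<bar>x - y\<bar> / ((golden_ratio + x) * (golden_ratio + y))"
  using moebius_abs_diff[of golden_ratio 1 x y 1 0] assms golden_ratio_gt_1
  by (simp add: golden_dist_def abs_mult)

lemma golden_dist_le: "x \<ge> 0 \<Longrightarrow> y \<ge> 0 \<Longrightarrow> golden_dist x y \<le> \<bar>x - y\<bar>"
proof -
  assume xy: "x \<ge> 0" "y \<ge> 0"
  then have "1 * 1 \<le> (golden_ratio + x) * (golden_ratio + y)"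
    using golden_ratio_gt_1 by (intro mult_mono) auto
  then have "\<bar>x - y\<bar> / ((golden_ratio + x) * (golden_ratio + y)) \<le> \<bar>x - y\<bar> / 1"
    by (intro divide_left_mono) auto
  then show ?thesis by (simp add: golden_dist_eq xy)
qed

lemma golden_dist_ge:
  assumes "x \<in> {0..1}" "y \<in> {0..1}"
  shows "\<bar>x - y\<bar> / 7 \<le> golden_dist x y"
proof -
  have "(golden_ratio + x) * (golden_ratio + y) \<le> (golden_ratio + 1) * (golden_ratio + 1)"
    using assms golden_ratio_gt_1 by (intro mult_mono) auto
  also have "\<dots> = 3 * golden_ratio + 2"
    using golden_ratio_square by (simp add: power2_eq_square algebra_simps)
  finally have "(golden_ratio + x) * (golden_ratio + y) \<le> 7"
    using golden_ratio_less by simp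
  then have "\<bar>x - y\<bar> / 7 \<le> \<bar>x - y\<bar> / ((golden_ratio + x) * (golden_ratio + y))"
    using assms golden_ratio_gt_1 by (intro divide_left_mono mult_pos_pos) auto
  then show ?thesis using assms by (simp add: golden_dist_eq)
qed

text \<open>
  For \<open>f = N / D\<close> with determinant \<open>\<plusminus>1\<close>, the function \<open>1 / (G + f)\<close> has denominator \<open>E = G D + N\<close>,
  so \<open>f\<close> turns the weights \<open>G + x\<close>, \<open>G + y\<close> into \<open>E x\<close>, \<open>E y\<close>. The loss per branch is thus bounded by
  comparing the affine functions \<open>E t\<close> and \<open>G^k (G + t)\<close>.
\<close>

lemma golden_dist_moebius_le:
  assumes "x \<ge> 0" "y \<ge> 0" "\<bar>d * p - c * q\<bar> = 1"
    and "\<And>t. t \<in> {x, y} \<Longrightarrow> 0 < p + q * t \<and> p + q * t \<le> golden_ratio ^ k * (golden_ratio + t)"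
    and "\<And>t. t \<in> {x, y} \<Longrightarrow> 1 / (golden_ratio + f t) = (c + d * t) / (p + q * t)"
  shows "golden_dist x y \<le> golden_ratio ^ (2 * k) * golden_dist (f x) (f y)"
proof -
  let ?G = golden_ratio
  have pos: "0 < p + q * x" "0 < p + q * y" using assms(4) by auto
  have "golden_dist (f x) (f y) = \<bar>x - y\<bar> / ((p + q * x) * (p + q * y))"
    using moebius_abs_diff[of p q x y c d] pos assms(3,5) by (simp add: golden_dist_def abs_mult)
  also have "\<dots> \<ge> \<bar>x - y\<bar> / ((?G ^ k * (?G + x)) * (?G ^ k * (?G + y)))"
    using assms(1,2,4) pos pos[THEN less_imp_le] golden_ratio_gt_1
    by (intro divide_left_mono mult_mono mult_pos_pos mult_nonneg_nonneg zero_le_power zero_less_power) auto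
  also have "\<bar>x - y\<bar> / ((?G ^ k * (?G + x)) * (?G ^ k * (?G + y))) = golden_dist x y / ?G ^ (2 * k)"
    using assms(1,2) by (simp add: golden_dist_eq mult_2 power_add)
  finally show ?thesis using golden_ratio_gt_1 by (simp add: field_simps)
qed

lemma golden_ratio_cube: "golden_ratio ^ 3 = 2 * golden_ratio + 1"
  using golden_ratio_square by (simp add: power3_eq_cube power2_eq_square algebra_simps)

text \<open>
  For the first branch both affine functions of \<open>golden_dist_moebius_le\<close> coincide, by the equation
  for \<open>G\<close>. The other two branches contract less than their index permits: the difference of the
  affine functions is \<open>1 + G (1 - t)\<close> and \<open>1 + (3G + 1) t\<close>, respectively.
\<close>

lemma golden_dist_branch:
  assumes "k \<in> {1, 2, 3}" "x \<in> {0..1}" "y \<in> {0..1}"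
  shows "golden_dist x y \<le> golden_ratio ^ (2 * k) * golden_dist (ocf_branch k x) (ocf_branch k y)"
proof -
  let ?G = golden_ratio
  have sq: "?G * ?G = ?G + 1" using golden_ratio_square by (simp add: power2_eq_square)
  have pos: "?G > 1" by (rule golden_ratio_gt_1)
  consider "k = 1" | "k = 2" | "k = 3" using assms(1) by auto
  then show ?thesis
  proof cases
    case 1
    show ?thesis unfolding 1
    proof (rule golden_dist_moebius_le[where c = 1 and d = 1 and p = "?G + 1" and q = "?G"])
      fix t assume "t \<in> {x, y}"
      then have t: "t \<ge> 0" using assms by auto
      have "(?G + 1) + ?G * t = ?G ^ 1 * (?G + t)" by (simp add: distrib_left sq)
      moreover have "0 < ?G ^ 1 * (?G + t)" using t pos by (intro mult_pos_pos) auto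
      ultimately show "0 < ?G + 1 + ?G * t \<and> ?G + 1 + ?G * t \<le> ?G ^ 1 * (?G + t)" by simp
      show "1 / (?G + ocf_branch 1 t) = (1 + 1 * t) / (?G + 1 + ?G * t)"
        using t pos by (simp add: ocf_branch_def field_simps)
    qed (use assms in auto)
  next
    case 2
    have E: "0 < ?G + (2 * ?G + 1) * t \<and> ?G + (2 * ?G + 1) * t \<le> ?G ^ 2 * (?G + t)"
      if "t \<in> {0..1}" for t
    proof
      show "0 < ?G + (2 * ?G + 1) * t" using that pos by (intro add_pos_nonneg) auto
      have "?G ^ 2 * (?G + t) - (?G + (2 * ?G + 1) * t) = 1 + ?G * (1 - t)"
        by (simp add: golden_ratio_square algebra_simps sq)
      moreover have "?G * (1 - t) \<ge> 0" using that pos by (intro mult_nonneg_nonneg) auto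
      ultimately show "?G + (2 * ?G + 1) * t \<le> ?G ^ 2 * (?G + t)" by linarith
    qed
    show ?thesis unfolding 2
      by (rule golden_dist_moebius_le[where c = 1 and d = 2 and p = "?G" and q = "2 * ?G + 1"])
         (use assms E pos in \<open>auto simp: ocf_branch_def field_simps\<close>)
  next
    case 3
    have E: "0 < 3 * ?G + 1 + - ?G * t \<and> 3 * ?G + 1 + - ?G * t \<le> ?G ^ 3 * (?G + t)"
      if "t \<in> {0..1}" for t
    proof
      have "?G * (1 - t) \<ge> 0" using that pos by (intro mult_nonneg_nonneg) auto
      then have "?G * t \<le> ?G" by (simp only: right_diff_distrib mult_1_right)
      then show "0 < 3 * ?G + 1 + - ?G * t" using pos by linarith
      have "?G ^ 3 * (?G + t) = 2 * (?G * ?G) + 2 * (?G * t) + ?G + t"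
        by (simp add: golden_ratio_cube algebra_simps)
      then have "?G ^ 3 * (?G + t) - (3 * ?G + 1 + - ?G * t) = 1 + 3 * (?G * t) + t"
        by (simp add: sq)
      moreover have "0 \<le> ?G * t" "0 \<le> t" using that pos by auto
      ultimately show "3 * ?G + 1 + - ?G * t \<le> ?G ^ 3 * (?G + t)" by linarith
    qed
    show ?thesis unfolding 3
      by (rule golden_dist_moebius_le[where c = 3 and d = "-1" and p = "3 * ?G + 1" and q = "- ?G"])
         (use assms E pos in \<open>auto simp: ocf_branch_def field_simps\<close>)
  qed
qed

text \<open>
  For the first branch the bound is an equality, which is why the exponent cannot be improved.
\<close>

lemma golden_dist_invert:
  assumes "x \<ge> 0" "y \<ge> 0"
  shows "golden_dist (ocf_branch 1 x) (ocf_branch 1 y) = golden_dist x y / golden_ratio ^ 2"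
proof -
  let ?G = golden_ratio
  have sq: "?G * ?G = ?G + 1" using golden_ratio_square by (simp add: power2_eq_square)
  have *: "1 / (?G + ocf_branch 1 t) = (1 + 1 * t) / ((?G + 1) + ?G * t)" if "t \<ge> 0" for t
    using that golden_ratio_gt_1 by (simp add: ocf_branch_def field_simps)
  have E: "(?G + 1) + ?G * t = ?G * (?G + t)" for t by (simp add: distrib_left sq)
  show ?thesis
    unfolding golden_dist_def[of "ocf_branch 1 x"] *[OF assms(1)] *[OF assms(2)]
    using assms golden_ratio_gt_1
    by (subst moebius_abs_diff) (auto simp: E golden_dist_eq abs_mult power2_eq_square)
qed

section \<open>The upper bound\<close>

definition QO_exponent :: real where
  "QO_exponent = ln ocf_lambda / (2 * ln golden_ratio)"

lemma QO_exponent_pos: "QO_exponent > 0"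
  using ocf_lambda_gt_1 golden_ratio_gt_1 by (simp add: QO_exponent_def)

text \<open>
  The exponent is chosen such that the contraction \<open>G\<^sup>-\<^sup>2\<^sup>k\<close> of a branch and the scaling \<open>\<lambda>\<^sup>-\<^sup>k\<close> of
  the function match.
\<close>

lemma golden_ratio_power_powr: "(golden_ratio ^ (2 * k)) powr QO_exponent = ocf_lambda ^ k"
proof -
  have "ln golden_ratio > 0" using golden_ratio_gt_1 by simp
  then have "QO_exponent * (2 * real k * ln golden_ratio) = real k * ln ocf_lambda"
    by (simp add: QO_exponent_def)
  then have "(golden_ratio ^ (2 * k)) powr QO_exponent = exp (real k * ln ocf_lambda)"
    using golden_ratio_gt_1 by (simp add: powr_def ln_realpow)
  also have "\<dots> = ocf_lambda ^ k"
    using ocf_lambda_gt_1 by (simp add: exp_of_nat_mult)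
  finally show ?thesis .
qed

text \<open>
  The Hoelder estimate for one pair of points, measured in the adapted distance. The error \<open>\<epsilon>\<close>
  makes an induction on the number of common branches possible: it starts from the trivial bound,
  and each branch divides the error by at least \<open>\<lambda>\<close> without touching \<open>C\<close>.
\<close>

definition QO_close :: "real \<Rightarrow> real \<Rightarrow> real \<Rightarrow> real \<Rightarrow> bool" where
  "QO_close C \<epsilon> x y \<longleftrightarrow> \<bar>QO x - QO y\<bar> \<le> C * golden_dist x y powr QO_exponent + \<epsilon>"

lemma QO_close_sym: "QO_close C \<epsilon> x y \<longleftrightarrow> QO_close C \<epsilon> y x"
  by (simp add: QO_close_def golden_dist_sym abs_minus_commute)

lemma QO_close_mono:
  assumes "QO_close C \<epsilon> x y" "C \<le> C'" "\<epsilon> \<le> \<epsilon>'"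
  shows "QO_close C' \<epsilon>' x y"
  using assms mult_right_mono[of C C' "golden_dist x y powr QO_exponent"]
  by (simp add: QO_close_def)

lemma QO_close_branch:
  assumes "k \<in> {1, 2, 3}" "x \<in> {0..1}" "y \<in> {0..1}" "C \<ge> 0" "\<epsilon> \<ge> 0" "QO_close C \<epsilon> x y"
  shows "QO_close C (\<epsilon> / ocf_lambda) (ocf_branch k x) (ocf_branch k y)"
proof -
  let ?N = "golden_dist (ocf_branch k x) (ocf_branch k y)"
  have l: "ocf_lambda ^ k > 0" using ocf_lambda_gt_1 by simp
  have "golden_dist x y powr QO_exponent \<le> (golden_ratio ^ (2 * k) * ?N) powr QO_exponent"
    using golden_dist_branch[OF assms(1-3)] QO_exponent_pos by (intro powr_mono2) auto
  also have "\<dots> = ocf_lambda ^ k * ?N powr QO_exponent"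
    using golden_ratio_gt_1 by (simp add: powr_mult golden_ratio_power_powr)
  finally have "C * golden_dist x y powr QO_exponent \<le> C * (ocf_lambda ^ k * ?N powr QO_exponent)"
    using assms(4) by (rule mult_left_mono)
  then have "\<bar>QO x - QO y\<bar> \<le> C * (ocf_lambda ^ k * ?N powr QO_exponent) + \<epsilon>"
    using assms(6) by (simp add: QO_close_def)
  then have "\<bar>QO x - QO y\<bar> / ocf_lambda ^ k
      \<le> (C * (ocf_lambda ^ k * ?N powr QO_exponent) + \<epsilon>) / ocf_lambda ^ k"
    by (rule divide_right_mono[OF _ less_imp_le[OF l]])
  also have "\<dots> = C * ?N powr QO_exponent + \<epsilon> / ocf_lambda ^ k"
    using ocf_lambda_gt_1 by (simp add: add_divide_distrib)
  finally have "\<bar>QO x - QO y\<bar> / ocf_lambda ^ k \<le> C * ?N powr QO_exponent + \<epsilon> / ocf_lambda ^ k" .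
  moreover have "\<epsilon> / ocf_lambda ^ k \<le> \<epsilon> / ocf_lambda ^ 1"
    using assms(1,5) ocf_lambda_gt_1 by (intro divide_left_mono power_increasing) auto
  ultimately show ?thesis by (simp add: QO_close_def abs_QO_branch_diff[OF assms(1-3)])
qed

lemma QO_close_limit:
  assumes "\<And>n. QO_close C (c / ocf_lambda ^ n) x y"
  shows "QO_close C 0 x y"
proof -
  have "(\<lambda>n. C * golden_dist x y powr QO_exponent + c * (1 / ocf_lambda) ^ n)
      \<longlonglongrightarrow> C * golden_dist x y powr QO_exponent + c * 0"
    using ocf_lambda_gt_1 by (intro tendsto_intros LIMSEQ_power_zero) auto
  then have "\<bar>QO x - QO y\<bar> \<le> C * golden_dist x y powr QO_exponent + c * 0"
    by (rule LIMSEQ_le_const) (use assms in \<open>auto simp: QO_close_def power_one_over\<close>)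
  then show ?thesis by (simp add: QO_close_def)
qed

definition QO_oscillation :: real where
  "QO_oscillation = 2 * (ocf_lambda / (ocf_lambda - 1))"

text \<open>
  The constant for which points at distance at least \<open>1/6\<close> satisfy the estimate trivially, their
  adapted distance being at least \<open>1 / (6 * 7)\<close>. The gap \<open>1/6\<close> is that between the two interior
  cut points \<open>1/3\<close> and \<open>1/2\<close>.
\<close>

definition QO_constant :: real where
  "QO_constant = QO_oscillation * 42 powr QO_exponent"

lemma QO_oscillation_pos: "QO_oscillation > 0"
  using ocf_lambda_gt_1 by (simp add: QO_oscillation_def)

lemma QO_constant_pos: "QO_constant > 0"
  using QO_oscillation_pos by (simp add: QO_constant_def)

lemma abs_QO_diff_le:
  "x \<in> {0..1} \<Longrightarrow> y \<in> {0..1} \<Longrightarrow> \<bar>QO x - QO y\<bar> \<le> QO_oscillation"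
  using abs_QO_le[of x] abs_QO_le[of y] by (simp add: QO_oscillation_def)

lemma QO_close_trivial:
  assumes "x \<in> {0..1}" "y \<in> {0..1}" "C \<ge> 0"
  shows "QO_close C QO_oscillation x y"
  using abs_QO_diff_le[OF assms(1,2)] assms(3) by (simp add: QO_close_def add_increasing)

lemma QO_close_far:
  assumes "x \<in> {0..1}" "y \<in> {0..1}" "\<bar>x - y\<bar> \<ge> 1 / 6"
  shows "QO_close QO_constant 0 x y"
proof -
  have "1 \<le> 42 * golden_dist x y" using golden_dist_ge[OF assms(1,2)] assms(3) by simp
  then have "1 \<le> (42 * golden_dist x y) powr QO_exponent"
    using QO_exponent_pos by (intro ge_one_powr_ge_zero) auto
  then have "QO_oscillation * 1 \<le> QO_oscillation * (42 * golden_dist x y) powr QO_exponent"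
    using QO_oscillation_pos by (intro mult_left_mono) auto
  then show ?thesis
    using abs_QO_diff_le[OF assms(1,2)] by (simp add: QO_close_def QO_constant_def powr_mult)
qed

lemma QO_close_branch_0:
  assumes "k \<in> {1, 2, 3}" "x \<in> {0..1}" "y \<in> {0..1}" "QO_close QO_constant 0 x y"
  shows "QO_close QO_constant 0 (ocf_branch k x) (ocf_branch k y)"
  using QO_close_branch[OF assms(1-3), of QO_constant 0] assms(4) QO_constant_pos by simp

text \<open>
  The estimate at the parabolic fixed point \<open>0\<close>: a point near \<open>0\<close> is moved away by undoing the second
  branch, which fixes \<open>0\<close>, until it exceeds \<open>1/3\<close>. The estimates at \<open>1\<close>, \<open>1/2\<close> and \<open>1/3\<close> follow from
  it, as these points are images of \<open>0\<close> or \<open>1\<close> under the branches on either side.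
\<close>

lemma QO_close_zero:
  assumes "x \<in> {0..1}"
  shows "QO_close QO_constant 0 x 0"
proof (rule QO_close_limit)
  show "QO_close QO_constant (QO_oscillation / ocf_lambda ^ n) x 0" for n
    using assms
  proof (induction n arbitrary: x)
    case 0
    then show ?case using QO_close_trivial[of x 0] QO_constant_pos by simp
  next
    case (Suc n)
    have eps: "QO_oscillation / ocf_lambda ^ m \<ge> 0" for m
      using QO_oscillation_pos ocf_lambda_gt_1 by simp
    show ?case
    proof (cases "x \<le> 1 / 3")
      case True
      then obtain y where y: "y \<in> {0..1}" "ocf_branch 2 y = x"
        using ocf_branch_2_surj[of x] Suc.prems by auto
      have "ocf_branch 2 0 = 0" by (simp add: ocf_branch_def)
      then show ?thesis
        using QO_close_branch[of 2 y 0, OF _ y(1) _ _ eps Suc.IH[OF y(1)]] y(2) QO_constant_pos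
        by (simp add: mult.commute)
    next
      case False
      then show ?thesis
        using QO_close_mono[OF QO_close_far[of x 0] order_refl eps[of "Suc n"]] Suc.prems by simp
    qed
  qed
qed

lemma QO_close_one:
  assumes "x \<in> {0..1}"
  shows "QO_close QO_constant 0 x 1"
proof (cases "x \<ge> 1 / 2")
  case True
  then obtain y where y: "y \<in> {0..1}" "ocf_branch 1 y = x"
    using ocf_branch_1_surj[of x] assms by auto
  have e: "ocf_branch 1 0 = 1" by (simp add: ocf_branch_def)
  show ?thesis using QO_close_branch_0[of 1 y 0, unfolded e y(2)] QO_close_zero y(1) by simp
qed (use assms QO_close_far[of x 1] in auto)

lemma QO_close_half:
  assumes "x \<in> {0..1}"
  shows "QO_close QO_constant 0 x (1 / 2)"
proof -
  consider "x < 1 / 3" | "x \<in> {1/3..1/2}" | "x \<in> {1/2..1}" using assms by force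
  then show ?thesis
  proof cases
    case 1
    then show ?thesis using assms QO_close_far[of x "1 / 2"] by auto
  next
    case 2
    then obtain y where y: "y \<in> {0..1}" "ocf_branch 3 y = x" using ocf_branch_3_surj by blast
    have e: "ocf_branch 3 1 = 1 / 2" by (simp add: ocf_branch_def)
    show ?thesis using QO_close_branch_0[of 3 y 1, unfolded e y(2)] QO_close_one y(1) by simp
  next
    case 3
    then obtain y where y: "y \<in> {0..1}" "ocf_branch 1 y = x" using ocf_branch_1_surj by blast
    have e: "ocf_branch 1 1 = 1 / 2" by (simp add: ocf_branch_def)
    show ?thesis using QO_close_branch_0[of 1 y 1, unfolded e y(2)] QO_close_one y(1) by simp
  qed
qed

lemma QO_close_third:
  assumes "x \<in> {0..1}"
  shows "QO_close QO_constant 0 x (1 / 3)"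
proof -
  consider "x > 1 / 2" | "x \<in> {1/3..1/2}" | "x \<in> {0..1/3}" using assms by force
  then show ?thesis
  proof cases
    case 1
    then show ?thesis using assms QO_close_far[of x "1 / 3"] by auto
  next
    case 2
    then obtain y where y: "y \<in> {0..1}" "ocf_branch 3 y = x" using ocf_branch_3_surj by blast
    have e: "ocf_branch 3 0 = 1 / 3" by (simp add: ocf_branch_def)
    show ?thesis using QO_close_branch_0[of 3 y 0, unfolded e y(2)] QO_close_zero y(1) by simp
  next
    case 3
    then obtain y where y: "y \<in> {0..1}" "ocf_branch 2 y = x" using ocf_branch_2_surj by blast
    have e: "ocf_branch 2 1 = 1 / 3" by (simp add: ocf_branch_def)
    show ?thesis using QO_close_branch_0[of 2 y 1, unfolded e y(2)] QO_close_one y(1) by simp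
  qed
qed

text \<open>
  The adapted distance is monotone in nested intervals, so an intermediate point costs a factor
  \<open>2\<close> only.
\<close>

lemma QO_close_join:
  assumes "0 \<le> x" "x \<le> m" "m \<le> y" "C \<ge> 0" "QO_close C 0 x m" "QO_close C 0 y m"
  shows "QO_close (2 * C) 0 x y"
proof -
  let ?h = "\<lambda>t. 1 / (golden_ratio + t)"
  have "?h m \<le> ?h x" "?h y \<le> ?h m"
    using assms(1-3) golden_ratio_gt_1 by (intro divide_left_mono mult_pos_pos; simp)+
  then have le: "golden_dist x m \<le> golden_dist x y" "golden_dist y m \<le> golden_dist x y"
    by (auto simp: golden_dist_def)
  have "C * golden_dist x m powr QO_exponent \<le> C * golden_dist x y powr QO_exponent"
    "C * golden_dist y m powr QO_exponent \<le> C * golden_dist x y powr QO_exponent"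
    using assms(4) QO_exponent_pos by (intro mult_left_mono powr_mono2 le; simp)+
  then show ?thesis using assms(5,6) unfolding QO_close_def by linarith
qed

text \<open>
  Two points in a common branch are replaced by their preimages; two points separated by a cut
  point are joined through it. The constant doubles only in the second case, and there the
  induction ends, so it doubles only once.
\<close>

lemma QO_close_unit:
  assumes "x \<in> {0..1}" "y \<in> {0..1}"
  shows "QO_close (2 * QO_constant) 0 x y"
proof (rule QO_close_limit)
  show "QO_close (2 * QO_constant) (QO_oscillation / ocf_lambda ^ n) x y" for n
    using assms
  proof (induction n arbitrary: x y)
    case 0
    then show ?case using QO_close_trivial[of x y] QO_constant_pos by simp
  next
    case (Suc n)
    have eps: "QO_oscillation / ocf_lambda ^ m \<ge> 0" for m
      using QO_oscillation_pos ocf_lambda_gt_1 by simp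
    have same: ?case if k: "k \<in> {1, 2, 3}"
      and ex: "\<exists>s\<in>{0..1}. ocf_branch k s = x" "\<exists>t\<in>{0..1}. ocf_branch k t = y" for k
    proof -
      obtain s t where st: "s \<in> {0..1}" "t \<in> {0..1}" "ocf_branch k s = x" "ocf_branch k t = y"
        using ex by blast
      show ?thesis
        using QO_close_branch[OF k st(1,2) _ eps Suc.IH[OF st(1,2)]] st(3,4) QO_constant_pos
        by (simp add: mult.commute)
    qed
    have apart: ?case if "m = 1 / 2 \<or> m = 1 / 3" "x \<le> m \<and> m \<le> y \<or> y \<le> m \<and> m \<le> x" for m
    proof -
      have m: "QO_close QO_constant 0 x m" "QO_close QO_constant 0 y m"
        using QO_close_half QO_close_third Suc.prems that(1) by blast+
      have "QO_close (2 * QO_constant) 0 x y"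
        using that(2)
      proof
        assume "x \<le> m \<and> m \<le> y"
        then show ?thesis using QO_close_join[of x m y] m Suc.prems QO_constant_pos by simp
      next
        assume "y \<le> m \<and> m \<le> x"
        then show ?thesis
          using QO_close_join[of y m x] m Suc.prems QO_constant_pos by (simp add: QO_close_sym)
      qed
      then show ?thesis using eps by (rule QO_close_mono[OF _ order_refl])
    qed
    consider "x \<le> 1/2 \<and> 1/2 \<le> y \<or> y \<le> 1/2 \<and> 1/2 \<le> x" | "x \<le> 1/3 \<and> 1/3 \<le> y \<or> y \<le> 1/3 \<and> 1/3 \<le> x"
      | "x \<in> {1/2..1}" "y \<in> {1/2..1}" | "x \<in> {0..1/3}" "y \<in> {0..1/3}"
      | "x \<in> {1/3..1/2}" "y \<in> {1/3..1/2}"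
      using Suc.prems by force
    then show ?case
    proof cases
      case 3
      then show ?thesis using same[of 1] ocf_branch_1_surj by blast
    next
      case 4
      then show ?thesis using same[of 2] ocf_branch_2_surj by blast
    next
      case 5
      then show ?thesis using same[of 3] ocf_branch_3_surj by blast
    qed (use apart in blast)+
  qed
qed

lemma QO_hoelder: "hoelder_continuous_on {0..1} QO_exponent QO"
  unfolding hoelder_continuous_on_def
proof (intro exI[of _ "2 * QO_constant"] conjI ballI)
  show "0 < 2 * QO_constant" using QO_constant_pos by simp
  fix x y :: real assume xy: "x \<in> {0..1}" "y \<in> {0..1}"
  have "golden_dist x y powr QO_exponent \<le> \<bar>x - y\<bar> powr QO_exponent"
    using xy QO_exponent_pos by (intro powr_mono2 golden_dist_le) auto
  then have "2 * QO_constant * golden_dist x y powr QO_exponent \<le> 2 * QO_constant * \<bar>x - y\<bar> powr QO_exponent"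
    using QO_constant_pos by (intro mult_left_mono) auto
  then show "\<bar>QO x - QO y\<bar> \<le> 2 * QO_constant * \<bar>x - y\<bar> powr QO_exponent"
    using QO_close_unit[OF xy] by (simp add: QO_close_def)
qed

section \<open>Optimality of the exponent\<close>

text \<open>
  The images of \<open>0\<close> and \<open>1\<close> under \<open>n\<close> iterations of the first branch, which are consecutive
  Fibonacci quotients, realise both the slowest decay of the function and the fastest decay of the
  distance.
\<close>

lemma QO_fibonacci_interval:
  "\<exists>u\<in>{0..1}. \<exists>v\<in>{0..1}. \<bar>QO u - QO v\<bar> = 1 / ocf_lambda ^ n \<and>
    \<bar>u - v\<bar> \<le> 7 / golden_ratio ^ (2 * n)"
proof -
  have "\<exists>u\<in>{0..1}. \<exists>v\<in>{0..1}. \<bar>QO u - QO v\<bar> = 1 / ocf_lambda ^ n \<and>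
    golden_dist u v \<le> 1 / golden_ratio ^ (2 * n)"
  proof (induction n)
    case 0
    have "golden_dist 0 1 \<le> 1" using golden_dist_le[of 0 1] by simp
    then show ?case by (intro bexI[of _ 0] bexI[of _ 1]) (auto simp: QO_0 QO_1)
  next
    case (Suc n)
    then obtain u v where uv: "u \<in> {0..1}" "v \<in> {0..1}" "\<bar>QO u - QO v\<bar> = 1 / ocf_lambda ^ n"
      "golden_dist u v \<le> 1 / golden_ratio ^ (2 * n)" by blast
    have "golden_dist (ocf_branch 1 u) (ocf_branch 1 v) = golden_dist u v / golden_ratio ^ 2"
      using uv(1,2) by (intro golden_dist_invert) auto
    also have "\<dots> \<le> 1 / golden_ratio ^ (2 * n) / golden_ratio ^ 2"
      using uv(4) golden_ratio_gt_1 by (intro divide_right_mono) auto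
    also have "\<dots> = 1 / golden_ratio ^ (2 * Suc n)" by (simp add: power_add power2_eq_square)
    finally have "golden_dist (ocf_branch 1 u) (ocf_branch 1 v) \<le> 1 / golden_ratio ^ (2 * Suc n)" .
    moreover have "\<bar>QO (ocf_branch 1 u) - QO (ocf_branch 1 v)\<bar> = 1 / ocf_lambda ^ Suc n"
      using abs_QO_branch_diff[of 1 u v] uv(1-3) by (simp add: mult.commute)
    ultimately show ?case
      using ocf_branch_unit[of 1 u] ocf_branch_unit[of 1 v] uv(1,2) by blast
  qed
  then obtain u v where uv: "u \<in> {0..1}" "v \<in> {0..1}" "\<bar>QO u - QO v\<bar> = 1 / ocf_lambda ^ n"
    "golden_dist u v \<le> 1 / golden_ratio ^ (2 * n)" by blast
  have "\<bar>u - v\<bar> \<le> 7 / golden_ratio ^ (2 * n)" using golden_dist_ge[OF uv(1,2)] uv(4) by simp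
  with uv(1-3) show ?thesis by blast
qed

lemma QO_not_hoelder:
  assumes "\<beta> > QO_exponent"
  shows "\<not> hoelder_continuous_on {0..1} \<beta> QO"
proof
  assume "hoelder_continuous_on {0..1} \<beta> QO"
  then obtain C where C: "C > 0"
    "\<And>x y. x \<in> {0..1} \<Longrightarrow> y \<in> {0..1} \<Longrightarrow> \<bar>QO x - QO y\<bar> \<le> C * \<bar>x - y\<bar> powr \<beta>"
    unfolding hoelder_continuous_on_def by blast
  define r where "r = golden_ratio powr (2 * \<beta>) / ocf_lambda"
  have "ocf_lambda = golden_ratio powr (2 * QO_exponent)"
    using golden_ratio_power_powr[of 1] golden_ratio_gt_1 by (simp add: powr_powr flip: powr_numeral)
  also have "\<dots> < golden_ratio powr (2 * \<beta>)"
    using assms golden_ratio_gt_1 by (intro powr_less_mono) auto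
  finally have "r > 1" using ocf_lambda_gt_1 by (simp add: r_def)
  then obtain n where n: "C * 7 powr \<beta> < r ^ n" using real_arch_pow by blast
  obtain u v where uv: "u \<in> {0..1}" "v \<in> {0..1}" "\<bar>QO u - QO v\<bar> = 1 / ocf_lambda ^ n"
    "\<bar>u - v\<bar> \<le> 7 / golden_ratio ^ (2 * n)" using QO_fibonacci_interval by blast
  have g: "(golden_ratio ^ (2 * n)) powr \<beta> = (golden_ratio powr (2 * \<beta>)) ^ n"
    using golden_ratio_gt_1 by (simp add: powr_powr mult_ac flip: powr_realpow)
  have "1 / ocf_lambda ^ n \<le> C * \<bar>u - v\<bar> powr \<beta>" using C(2)[OF uv(1,2)] uv(3) by simp
  also have "\<dots> \<le> C * (7 / golden_ratio ^ (2 * n)) powr \<beta>"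
    using uv(4) C(1) assms QO_exponent_pos by (intro mult_left_mono powr_mono2) auto
  also have "\<dots> = C * 7 powr \<beta> / (golden_ratio powr (2 * \<beta>)) ^ n"
    using golden_ratio_gt_1 by (simp add: powr_divide g)
  finally have "r ^ n \<le> C * 7 powr \<beta>"
    using golden_ratio_gt_1 ocf_lambda_gt_1 by (simp add: r_def power_divide field_simps)
  with n show False by simp
qed

theorem theorem4:
  fixes \<alpha> :: real
  defines "\<alpha> \<equiv> ln ocf_lambda / (2 * ln golden_ratio)"
  shows "hoelder_continuous_on {0..1} \<alpha> QO \<and>
         (\<forall>\<beta>>\<alpha>. \<not> hoelder_continuous_on {0..1} \<beta> QO)"
  using QO_hoelder QO_not_hoelder unfolding \<alpha>_def QO_exponent_def by blast

end
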